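(* For each integer $c\ge 1$ let $N_c := \min\{n : (c,n) \text{ is firm}\}$ (with $N_c=\infty$ if no such $n$ exists). Then $$N_1 = 1,\quad N_2 = 3,\quad N_3 = 5,\quad N_4 = 8,\quad N_5 = 11,\quad N_6 = 14.$$
   Context: Fix an algebraically closed ground field $k$ of characteristic zero. For positive integers $a_1,\ldots,a_c$ and $n\ge c$, a complete intersection $X=X(a_1,\ldots,a_c)\subset\mathbb{P}^n_k$ of codimension $c$ is a closed subscheme of codimension $c$ whose defining ideal is generated by $c$ homogeneous polynomials $f_1,\ldots,f_c$ (a regular sequence) with $\deg f_i=a_i$; $(a_1,\ldots,a_c)$ is its degree sequence, considered up to permutation. $P_X(t)$ denotes the Hilbert polynomial of $X\subset \mathbb{P}^n$. For integers $n\ge c\ge 1$, the pair $(c,n)$ is called firm if the degree sequence of any codimension $c$ complete intersection in $\mathbb{P}^n$ is determined by its Hilbert polynomial; that is, whenever $X(a_1,\ldots,a_c)$ and $X(b_1,\ldots,b_c)$ in $\mathbb{P}^n$ have the same Hilbert polynomial, $(b_1,\ldots,b_c)$ is a permutation of $(a_1,\ldots,a_c)$. *)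

theory Defs
  imports
    "HOL-Library.Poly_Mapping"
    "HOL-Library.Extended_Nat"
    "HOL-Library.Multiset"
    "HOL-Computational_Algebra.Polynomial"
begin

text \<open>Polynomials in the variables \<open>x\<^sub>0, x\<^sub>1, \<dots>\<close>: finitely supported maps from exponent vectors
  to coefficients. The ring \<open>k[x\<^sub>0, \<dots>, x\<^sub>n]\<close> is the subring \<open>coord_ring n\<close>.\<close>

type_synonym 'k mpoly = "(nat \<Rightarrow>\<^sub>0 nat) \<Rightarrow>\<^sub>0 'k"

definition coord_ring :: "nat \<Rightarrow> 'k::field mpoly set" where
  "coord_ring n = {p. \<forall>m\<in>Poly_Mapping.keys p. Poly_Mapping.keys m \<subseteq> {..n}}"

definition mono_degree :: "(nat \<Rightarrow>\<^sub>0 nat) \<Rightarrow> nat" where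
  "mono_degree m = (\<Sum>i\<in>Poly_Mapping.keys m. Poly_Mapping.lookup m i)"

text \<open>As usual, zero is a form of every degree.\<close>

definition forms :: "nat \<Rightarrow> nat \<Rightarrow> 'k::field mpoly set" where
  "forms n d = {p \<in> coord_ring n. \<forall>m\<in>Poly_Mapping.keys p. mono_degree m = d}"

definition scal :: "'k::field \<Rightarrow> 'k mpoly \<Rightarrow> 'k mpoly" where
  "scal c p = Poly_Mapping.map ((*) c) p"

lemma scal_conv_mult: "scal c p = Poly_Mapping.single 0 c * p"
  by (simp add: scal_def mult_map_scale_conv_mult)

global_interpretation mpoly: vector_space "scal :: 'k::field \<Rightarrow> 'k mpoly \<Rightarrow> 'k mpoly"
  by unfold_locales
    (simp_all add: scal_conv_mult algebra_simps single_add mult_single flip: mult.assoc)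

definition ideal_gen :: "nat \<Rightarrow> 'k::field mpoly list \<Rightarrow> 'k mpoly set" where
  "ideal_gen n fs =
     {\<Sum>i<length fs. g i * fs ! i | g. \<forall>i<length fs. g i \<in> coord_ring n}"

definition regular_sequence :: "nat \<Rightarrow> 'k::field mpoly list \<Rightarrow> bool" where
  "regular_sequence n fs \<longleftrightarrow>
     (\<forall>i<length fs. \<forall>g\<in>coord_ring n.
        g * fs ! i \<in> ideal_gen n (take i fs) \<longrightarrow> g \<in> ideal_gen n (take i fs)) \<and>
     ideal_gen n fs \<noteq> coord_ring n"

text \<open>Saturation with respect to the irrelevant ideal \<open>(x\<^sub>0, \<dots>, x\<^sub>n)\<close>, whose \<open>N\<close>-th power is
  generated by the forms of degree \<open>N\<close>.\<close>

definition saturated :: "nat \<Rightarrow> 'k::field mpoly set \<Rightarrow> bool" where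
  "saturated n I \<longleftrightarrow>
     (\<forall>g\<in>coord_ring n. (\<exists>N. \<forall>h\<in>forms n N. h * g \<in> I) \<longrightarrow> g \<in> I)"

text \<open>A closed subscheme of \<open>\<P>\<^sup>n\<close> is represented by its defining (homogeneous, saturated) ideal,
  and \<open>complete_intersection n ds I\<close> says that \<open>I\<close> defines a complete intersection with
  degree sequence \<open>ds\<close>. It is used for \<open>length ds \<le> n\<close>; that the codimension is \<open>length ds\<close> is
  then expressed by the regularity of the sequence of generators.\<close>

definition complete_intersection :: "nat \<Rightarrow> nat list \<Rightarrow> 'k::field mpoly set \<Rightarrow> bool" where
  "complete_intersection n ds I \<longleftrightarrow>
     (\<forall>d\<in>set ds. 0 < d) \<and> saturated n I \<and>
     (\<exists>fs. length fs = length ds \<and> (\<forall>i<length ds. fs ! i \<in> forms n (ds ! i)) \<and>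
        regular_sequence n fs \<and> I = ideal_gen n fs)"

text \<open>The dimension of the degree \<open>d\<close> part of \<open>k[x\<^sub>0, \<dots>, x\<^sub>n] / I\<close>, for a homogeneous ideal \<open>I\<close>.\<close>

definition hilbert_function :: "nat \<Rightarrow> 'k::field mpoly set \<Rightarrow> nat \<Rightarrow> nat" where
  "hilbert_function n I d =
     mpoly.dim (forms n d :: 'k mpoly set) - mpoly.dim (I \<inter> forms n d)"

definition hilbert_polynomial :: "nat \<Rightarrow> 'k::field mpoly set \<Rightarrow> rat poly" where
  "hilbert_polynomial n I =
     (THE P. \<exists>d0. \<forall>d\<ge>d0. poly P (of_nat d) = of_nat (hilbert_function n I d))"

definition firm :: "'k::field itself \<Rightarrow> nat \<Rightarrow> nat \<Rightarrow> bool" where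
  "firm k c n \<longleftrightarrow> 1 \<le> c \<and> c \<le> n \<and>
     (\<forall>as bs. \<forall>(X :: 'k mpoly set) (Y :: 'k mpoly set).
        length as = c \<longrightarrow> length bs = c \<longrightarrow>
        complete_intersection n as X \<longrightarrow> complete_intersection n bs Y \<longrightarrow>
        hilbert_polynomial n X = hilbert_polynomial n Y \<longrightarrow> mset as = mset bs)"

text \<open>The infimum of the empty set in \<^typ>\<open>enat\<close> is \<open>\<infinity>\<close>.\<close>

definition firm_threshold :: "'k::field itself \<Rightarrow> nat \<Rightarrow> enat" where
  "firm_threshold k c = Inf (enat ` {n. firm k c n})"

end

theory Submission
  imports Defs "HOL-Computational_Algebra.Polynomial_FPS"
begin

text \<open>
  A complete intersection of degrees \<open>a\<^sub>1, \<dots>, a\<^sub>c\<close> in \<open>\<P>\<^sup>n\<close> has Hilbert series \<open>\<Prod> (1 - x ^ a\<^sub>i) / (1 - x) ^ (n + 1)\<close>,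
  since dividing by a regular form of degree \<open>a\<close> multiplies the series by \<open>1 - x\<^sup>a\<close>. Consequently two complete
  intersections have the same Hilbert polynomial exactly if their numerators agree to order \<open>n + 1\<close> at
  \<open>x = 1\<close> (\<open>hilbert_polynomial_eq_iff\<close>). Put \<open>x = e\<^sup>s\<close> and \<open>m = n - c\<close>. The factor \<open>1 - e\<^sup>a\<^sup>s\<close> is \<open>-a s\<close> times a series with
  constant term \<open>1\<close> whose logarithm is \<open>a s / 2\<close> plus an even series, with coefficients that are Bernoulli
  numbers up to nonzero factors. Hence the Hilbert polynomial amounts to knowing the product of the degrees, their sum if \<open>m \<ge> 1\<close>, and their power
  sums of even exponent up to \<open>m\<close> (\<open>hilbert_numerator_contact_iff\<close>).

  It remains to see how many of these symmetric functions determine \<open>c\<close> positive integers. Even power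
  sums are equivalent to the low coefficients of \<open>E(t) E(-t)\<close>, where \<open>E(t) = \<Prod> (1 + a\<^sub>i t)\<close>, so they give quadratic
  equations for the elementary symmetric functions \<open>e\<^sub>k\<close>. Given \<open>e\<^sub>1\<close>, \<open>e\<^sub>2\<close> and \<open>e\<^sub>c\<close>, these have at most one
  solution coming from positive numbers if \<open>c \<le> 6\<close> and \<open>m\<close> is as large as claimed; the reason is that a
  Hurwitz determinant of a polynomial with negative real roots is positive. It is \<open>e\<^sub>1\<close> for \<open>c = 4\<close>,
  \<open>e\<^sub>1 e\<^sub>2 - e\<^sub>3\<close> for \<open>c = 5\<close>, and \<open>e\<^sub>1 e\<^sub>2 e\<^sub>3 - e\<^sub>3\<^sup>2 - e\<^sub>1\<^sup>2 e\<^sub>4 + e\<^sub>1 e\<^sub>5\<close> for \<open>c = 6\<close> (\<open>mset_eq_of_psums\<close>). For smaller \<open>m\<close>, explicit pairs of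
  degree sequences agree in all the symmetric functions in question; they are realised by the ideals
  \<open>(x\<^sub>0 ^ a\<^sub>1, \<dots>, x\<^sub>c\<^sub>-\<^sub>1 ^ a\<^sub>c)\<close> (\<open>complete_intersection_power_monomials\<close>, \<open>not_firm_if\<close>).
\<close>

unbundle fps_syntax

section \<open>Dimensions of sums of subspaces\<close>

text \<open>Rank--nullity for the map induced by \<open>\<phi>\<close> from \<open>V\<close> to the ambient space modulo \<open>U\<close>, phrased without quotients and inside a space that
may be infinite-dimensional: a basis of \<open>U\<close> together with the images of the vectors that complete a
basis of the kernel to one of \<open>V\<close> is a basis of \<open>U + \<phi> V\<close>.\<close>

lemma (in vector_space) dim_plus_linear_image:
  assumes lin: "Vector_Spaces.linear scale scale \<phi>"
    and U: "subspace U" and V: "subspace V"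
    and fU: "finite S" "U \<subseteq> span S" and fV: "finite T" "V \<subseteq> span T"
  shows "dim {u + \<phi> v | u v. u \<in> U \<and> v \<in> V} + dim {v \<in> V. \<phi> v \<in> U} = dim U + dim V"
proof -
  interpret L: Vector_Spaces.linear scale scale \<phi> by (fact lin)
  let ?K = "{v \<in> V. \<phi> v \<in> U}"
  let ?W = "{u + \<phi> v | u v. u \<in> U \<and> v \<in> V}"
  have subK: "subspace ?K"
    using U V by (auto simp: subspace_def L.add L.scale L.zero)
  obtain B where B: "B \<subseteq> U" "independent B" "U \<subseteq> span B" "card B = dim U"
    by (rule basis_exists)
  obtain K0 where K0: "K0 \<subseteq> ?K" "independent K0" "?K \<subseteq> span K0" "card K0 = dim ?K"
    by (rule basis_exists)
  obtain E where E: "K0 \<subseteq> E" "E \<subseteq> V" "independent E" "V \<subseteq> span E"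
    using maximal_independent_subset_extend[of K0 V] K0 by blast
  have finB: "finite B" using independent_span_bound[of S B] fU B by blast
  have finE: "finite E" using independent_span_bound[of T E] fV E by blast
  have spB: "span B = U" using B U span_minimal by blast
  have spK0: "span K0 = ?K" using K0 subK span_minimal by blast
  have dimV: "card E = dim V" using basis_card_eq_dim E by blast
  \<comment> \<open>Adding the completing vectors one by one keeps independence: a relation would put one of them
    into the kernel modulo the earlier ones.\<close>
  have main: "independent (B \<union> \<phi> ` C) \<and> card (B \<union> \<phi> ` C) = card B + card C"
    if "C \<subseteq> E - K0" "finite C" for C
    using that(2,1)
  proof (induction C rule: finite_induct)
    case empty
    then show ?case using B by simp
  next
    case (insert c C)
    have notin: "\<phi> c \<notin> span (B \<union> \<phi> ` C)"
    proof
      assume "\<phi> c \<in> span (B \<union> \<phi> ` C)"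
      then obtain u w where w: "\<phi> c = u + \<phi> w" "u \<in> U" "w \<in> span C"
        unfolding span_Un L.span_image spB by blast
      have "C \<subseteq> V" using insert.prems E by blast
      then have "w \<in> V" using w(3) V span_minimal by blast
      moreover have "c \<in> V" using E insert.prems by blast
      moreover have "\<phi> (c - w) = u" using w by (simp add: L.diff)
      ultimately have "c - w \<in> ?K" using w V by (simp add: subspace_diff)
      then have "c - w \<in> span (K0 \<union> C)" using K0(3) span_mono[of K0 "K0 \<union> C"] by blast
      moreover have "w \<in> span (K0 \<union> C)" using w(3) span_mono[of C "K0 \<union> C"] by blast
      ultimately have "c \<in> span (K0 \<union> C)" using span_add by fastforce
      moreover have "K0 \<union> C \<subseteq> E - {c}" using insert E by auto
      ultimately have "c \<in> span (E - {c})" using span_mono by blast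
      moreover have "c \<in> E" using insert.prems by blast
      ultimately have "dependent E" unfolding dependent_def by blast
      then show False using E(3) by simp
    qed
    then have nin: "\<phi> c \<notin> B \<union> \<phi> ` C" by (meson span_base)
    have IH: "independent (B \<union> \<phi> ` C)" "card (B \<union> \<phi> ` C) = card B + card C"
      using insert by auto
    have ins: "B \<union> \<phi> ` insert c C = insert (\<phi> c) (B \<union> \<phi> ` C)" by blast
    have "card (insert (\<phi> c) (B \<union> \<phi> ` C)) = Suc (card (B \<union> \<phi> ` C))"
      using nin finB insert.hyps(1) by (intro card_insert_disjoint) auto
    then show ?case
      unfolding ins using independent_insertI[OF notin IH(1)] IH(2) insert.hyps by simp
  qed
  define C where "C = E - K0"
  have C: "independent (B \<union> \<phi> ` C)" "card (B \<union> \<phi> ` C) = card B + card C"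
    using main[of C] finE by (auto simp: C_def)
  have spE: "E = K0 \<union> C" using E by (auto simp: C_def)
  have W1: "B \<union> \<phi> ` C \<subseteq> ?W"
  proof -
    have "b \<in> ?W" if "b \<in> B" for b
    proof -
      have "b = b + \<phi> 0" "b \<in> U" "0 \<in> V" using that B V by (auto simp: L.zero subspace_0)
      then show ?thesis by blast
    qed
    moreover have "\<phi> c \<in> ?W" if "c \<in> C" for c
    proof -
      have "\<phi> c = 0 + \<phi> c" "0 \<in> U" "c \<in> V" using that E U by (auto simp: C_def subspace_0)
      then show ?thesis by blast
    qed
    ultimately show ?thesis by blast
  qed
  have W2: "?W \<subseteq> span (B \<union> \<phi> ` C)"
  proof clarify
    fix u v assume uv: "u \<in> U" "v \<in> V"
    have "v \<in> span (K0 \<union> C)" using uv E spE by blast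
    then obtain a b where ab: "v = a + b" "a \<in> ?K" "b \<in> span C"
      unfolding span_Un spK0 by blast
    have "u + \<phi> a \<in> span B" using ab uv U spB subspace_add by auto
    moreover have "\<phi> b \<in> span (\<phi> ` C)" using ab L.span_image by blast
    ultimately have "(u + \<phi> a) + \<phi> b \<in> span (B \<union> \<phi> ` C)" unfolding span_Un by blast
    then show "u + \<phi> v \<in> span (B \<union> \<phi> ` C)" using ab by (simp add: L.add add.assoc)
  qed
  have "dim ?W = card B + card C"
    using dim_unique[OF W1 W2 C(1) C(2)] .
  moreover have "card E = card K0 + card C"
    using finE E by (simp add: C_def card_Diff_subset card_mono finite_subset)
  ultimately show ?thesis using B(4) K0(4) dimV by linarith
qed

section \<open>Forms and homogeneous components\<close>

lemma mono_degree_eq_sum: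
  "finite A \<Longrightarrow> Poly_Mapping.keys m \<subseteq> A \<Longrightarrow> mono_degree m = (\<Sum>i\<in>A. Poly_Mapping.lookup m i)"
  unfolding mono_degree_def by (rule sum.mono_neutral_left) (auto simp: in_keys_iff)

lemma mono_degree_add: "mono_degree (m + m') = mono_degree m + mono_degree m'"
proof -
  let ?A = "Poly_Mapping.keys m \<union> Poly_Mapping.keys m'"
  have "Poly_Mapping.keys (m + m') \<subseteq> ?A" by (rule Poly_Mapping.keys_add)
  then have "mono_degree (m + m') = (\<Sum>i\<in>?A. Poly_Mapping.lookup (m + m') i)"
    by (intro mono_degree_eq_sum) auto
  moreover have "mono_degree m = (\<Sum>i\<in>?A. Poly_Mapping.lookup m i)"
    by (intro mono_degree_eq_sum) auto
  moreover have "mono_degree m' = (\<Sum>i\<in>?A. Poly_Mapping.lookup m' i)"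
    by (intro mono_degree_eq_sum) auto
  ultimately show ?thesis by (simp only: lookup_add sum.distrib)
qed

lemma mono_degree_single [simp]: "mono_degree (Poly_Mapping.single i a) = a"
  by (simp add: mono_degree_def)

lemma keys_scal: "Poly_Mapping.keys (scal c p) \<subseteq> Poly_Mapping.keys p"
  unfolding scal_def by (auto simp: in_keys_iff map.rep_eq)

lemma lookup_scal [simp]: "Poly_Mapping.lookup (scal c p) m = c * Poly_Mapping.lookup p m"
  unfolding scal_def by (simp add: map.rep_eq when_def)

lemma coord_ring_closed:
  shows coord_ring_0: "(0 :: 'a::field mpoly) \<in> coord_ring n"
    and coord_ring_1: "(1 :: 'a::field mpoly) \<in> coord_ring n"
    and coord_ring_add: "(p :: 'a::field mpoly) \<in> coord_ring n \<Longrightarrow> q \<in> coord_ring n \<Longrightarrow> p + q \<in> coord_ring n"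
    and coord_ring_scal: "(p :: 'a::field mpoly) \<in> coord_ring n \<Longrightarrow> scal c p \<in> coord_ring n"
    and coord_ring_mult: "(p :: 'a::field mpoly) \<in> coord_ring n \<Longrightarrow> q \<in> coord_ring n \<Longrightarrow> p * q \<in> coord_ring n"
proof -
  show "p * q \<in> coord_ring n" if "p \<in> coord_ring n" "q \<in> coord_ring n" for p q :: "'a mpoly"
    unfolding coord_ring_def
  proof clarify
    fix m i assume m: "m \<in> Poly_Mapping.keys (p * q)" and i: "i \<in> Poly_Mapping.keys m"
    obtain a b where ab: "m = a + b" "a \<in> Poly_Mapping.keys p" "b \<in> Poly_Mapping.keys q"
      using keys_mult[of p q] m by blast
    have "i \<in> Poly_Mapping.keys a \<union> Poly_Mapping.keys b"
      using Poly_Mapping.keys_add[of a b] i ab(1) by blast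
    then show "i \<le> n" using ab that unfolding coord_ring_def by blast
  qed
  show "p + q \<in> coord_ring n" if "p \<in> coord_ring n" "q \<in> coord_ring n" for p q :: "'a mpoly"
    using Poly_Mapping.keys_add[of p q] that unfolding coord_ring_def by blast
  show "scal c p \<in> coord_ring n" if "p \<in> coord_ring n" for c and p :: "'a mpoly"
    using keys_scal[of c p] that unfolding coord_ring_def by blast
qed (auto simp: coord_ring_def)

lemma subspace_coord_ring: "mpoly.subspace (coord_ring n)"
  by (simp add: mpoly.subspace_def coord_ring_closed)

lemma coord_ring_sum: "(\<And>i. i \<in> A \<Longrightarrow> f i \<in> coord_ring n) \<Longrightarrow> sum f A \<in> coord_ring n"
  using mpoly.subspace_sum[OF subspace_coord_ring] by blast

lemma subspace_forms: "mpoly.subspace (forms n d)"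
proof -
  have "p + q \<in> forms n d" if "p \<in> forms n d" "q \<in> forms n d" for p q :: "'a mpoly"
    using that Poly_Mapping.keys_add[of p q] unfolding forms_def
    by (auto simp: coord_ring_add)
  moreover have "scal c p \<in> forms n d" if "p \<in> forms n d" for c and p :: "'a mpoly"
    using that keys_scal[of c p] unfolding forms_def by (auto simp: coord_ring_scal)
  moreover have "0 \<in> forms n d" by (simp add: forms_def coord_ring_0)
  ultimately show ?thesis by (simp add: mpoly.subspace_def)
qed

lemma forms_mult: "p \<in> forms n a \<Longrightarrow> q \<in> forms n b \<Longrightarrow> p * q \<in> forms n (a + b)"
  using keys_mult[of p q] unfolding forms_def by (auto simp: coord_ring_mult mono_degree_add)

lemma forms_imp_coord_ring: "p \<in> forms n d \<Longrightarrow> p \<in> coord_ring n"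
  by (simp add: forms_def)

definition homogeneous_part :: "nat \<Rightarrow> 'k::field mpoly \<Rightarrow> 'k mpoly" where
  "homogeneous_part d p = Poly_Mapping.mapp (\<lambda>m c. c when mono_degree m = d) p"

lemma lookup_homogeneous_part: "Poly_Mapping.lookup (homogeneous_part d p) m = (Poly_Mapping.lookup p m when mono_degree m = d)"
  by (auto simp: homogeneous_part_def lookup_mapp when_def in_keys_iff)

lemma homogeneous_part_add: "homogeneous_part d (p + q) = homogeneous_part d p + homogeneous_part d q"
  by (rule poly_mapping_eqI) (simp add: lookup_homogeneous_part lookup_add when_add_distrib)

lemma homogeneous_part_0: "homogeneous_part d 0 = 0"
  by (rule poly_mapping_eqI) (simp add: lookup_homogeneous_part)

lemma homogeneous_part_sum: "homogeneous_part d (sum f A) = (\<Sum>i\<in>A. homogeneous_part d (f i))"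
  by (induction A rule: infinite_finite_induct) (simp_all add: homogeneous_part_0 homogeneous_part_add)

lemma homogeneous_part_in_forms: "p \<in> coord_ring n \<Longrightarrow> homogeneous_part d p \<in> forms n d"
  unfolding forms_def coord_ring_def by (auto simp: in_keys_iff lookup_homogeneous_part)

lemma homogeneous_part_forms: "p \<in> forms n a \<Longrightarrow> homogeneous_part d p = (if a = d then p else 0)"
  by (rule poly_mapping_eqI) (auto simp: lookup_homogeneous_part forms_def in_keys_iff when_def)

lemma sum_homogeneous_part:
  assumes "finite D" "mono_degree ` Poly_Mapping.keys p \<subseteq> D"
  shows "p = (\<Sum>d\<in>D. homogeneous_part d p)"
proof (rule poly_mapping_eqI)
  fix m
  have "(\<Sum>d\<in>D. Poly_Mapping.lookup p m when mono_degree m = d)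
      = (if mono_degree m \<in> D then Poly_Mapping.lookup p m else 0)"
    using assms(1) by (simp add: when_def)
  also have "\<dots> = Poly_Mapping.lookup p m"
    using assms(2) in_keys_iff[of m p] by (auto simp: image_subset_iff)
  finally show "Poly_Mapping.lookup p m = Poly_Mapping.lookup (\<Sum>d\<in>D. homogeneous_part d p) m"
    by (simp add: lookup_sum lookup_homogeneous_part)
qed

lemma homogeneous_part_mult_form:
  assumes g: "g \<in> coord_ring n" and f: "f \<in> forms n a"
  shows "homogeneous_part d (g * f) = (if a \<le> d then homogeneous_part (d - a) g * f else 0)"
proof -
  let ?D = "insert (d - a) (mono_degree ` Poly_Mapping.keys g)"
  have "g = (\<Sum>e\<in>?D. homogeneous_part e g)" by (rule sum_homogeneous_part) auto
  then have "g * f = (\<Sum>e\<in>?D. homogeneous_part e g) * f" by simp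
  then have "g * f = (\<Sum>e\<in>?D. homogeneous_part e g * f)" unfolding sum_distrib_right .
  then have "homogeneous_part d (g * f) = (\<Sum>e\<in>?D. homogeneous_part d (homogeneous_part e g * f))"
    by (simp add: homogeneous_part_sum)
  also have "\<dots> = (\<Sum>e\<in>?D. if e + a = d then homogeneous_part e g * f else 0)"
    using homogeneous_part_forms[OF forms_mult[OF homogeneous_part_in_forms[OF g] f]] by simp
  also have "\<dots> = (\<Sum>e\<in>?D. if e = d - a then (if a \<le> d then homogeneous_part e g * f else 0) else 0)"
    by (rule sum.cong) auto
  also have "\<dots> = (if a \<le> d then homogeneous_part (d - a) g * f else 0)"
    by (subst sum.delta) auto
  finally show ?thesis .
qed

section \<open>Ideals generated by forms\<close>

lemma ideal_gen_Nil: "ideal_gen n [] = {0}"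
  by (auto simp: ideal_gen_def)

lemma ideal_gen_take_Suc:
  assumes "i < length fs"
  shows "ideal_gen n (take (Suc i) fs)
    = {p + g * fs ! i | p g. p \<in> ideal_gen n (take i fs) \<and> g \<in> coord_ring n}" (is "?L = ?R")
proof
  show "?L \<subseteq> ?R"
  proof
    fix x assume "x \<in> ?L"
    then obtain g where g: "x = (\<Sum>j<Suc i. g j * fs ! j)" "\<forall>j<Suc i. g j \<in> coord_ring n"
      using assms unfolding ideal_gen_def by auto
    have "x = (\<Sum>j<i. g j * fs ! j) + g i * fs ! i" using g by simp
    moreover have "(\<Sum>j<i. g j * fs ! j) \<in> ideal_gen n (take i fs)"
      using g assms unfolding ideal_gen_def by auto
    ultimately show "x \<in> ?R" using g by blast
  qed
  show "?R \<subseteq> ?L"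
  proof clarify
    fix p g :: "'a mpoly" assume p: "p \<in> ideal_gen n (take i fs)" and g: "g \<in> coord_ring n"
    then obtain h where h: "p = (\<Sum>j<i. h j * fs ! j)" "\<forall>j<i. h j \<in> coord_ring n"
      using assms unfolding ideal_gen_def by auto
    define h' where "h' = h(i := g)"
    have "p + g * fs ! i = (\<Sum>j<Suc i. h' j * fs ! j)" using h by (simp add: h'_def)
    moreover have "\<forall>j<Suc i. h' j \<in> coord_ring n" using h g by (auto simp: h'_def)
    ultimately show "p + g * fs ! i \<in> ?L"
      using assms unfolding ideal_gen_def by (auto intro!: exI[of _ h'])
  qed
qed

lemma ideal_gen_closed:
  shows ideal_gen_0: "0 \<in> ideal_gen n fs"
    and ideal_gen_add: "p \<in> ideal_gen n fs \<Longrightarrow> q \<in> ideal_gen n fs \<Longrightarrow> p + q \<in> ideal_gen n fs"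
    and ideal_gen_mult: "r \<in> coord_ring n \<Longrightarrow> p \<in> ideal_gen n fs \<Longrightarrow> r * p \<in> ideal_gen n fs"
proof -
  show "0 \<in> ideal_gen n fs"
    unfolding ideal_gen_def by (auto intro!: exI[of _ "\<lambda>_. 0"] simp: coord_ring_0)
  show "p + q \<in> ideal_gen n fs" if p: "p \<in> ideal_gen n fs" and q: "q \<in> ideal_gen n fs" for p q
  proof -
    obtain g where "p = (\<Sum>j<length fs. g j * fs ! j)" "\<forall>j<length fs. g j \<in> coord_ring n"
      using p unfolding ideal_gen_def by auto
    moreover obtain h where "q = (\<Sum>j<length fs. h j * fs ! j)" "\<forall>j<length fs. h j \<in> coord_ring n"
      using q unfolding ideal_gen_def by auto
    ultimately show ?thesis unfolding ideal_gen_def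
      by (auto intro!: exI[of _ "\<lambda>j. g j + h j"] simp: coord_ring_add distrib_right sum.distrib)
  qed
  show "r * p \<in> ideal_gen n fs" if r: "r \<in> coord_ring n" and p: "p \<in> ideal_gen n fs" for r p
  proof -
    obtain g where "p = (\<Sum>j<length fs. g j * fs ! j)" "\<forall>j<length fs. g j \<in> coord_ring n"
      using p unfolding ideal_gen_def by auto
    then show ?thesis unfolding ideal_gen_def using r
      by (auto intro!: exI[of _ "\<lambda>j. r * g j"] simp: coord_ring_mult sum_distrib_left mult.assoc)
  qed
qed

lemma subspace_ideal_gen: "mpoly.subspace (ideal_gen n fs)"
proof -
  have "Poly_Mapping.single 0 c \<in> coord_ring n" for c :: 'a
    by (auto simp: coord_ring_def)
  then show ?thesis
    by (simp add: mpoly.subspace_def ideal_gen_closed scal_conv_mult)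
qed

lemma homogeneous_part_ideal_gen:
  assumes "\<forall>i<length fs. fs ! i \<in> forms n (ds ! i)" "p \<in> ideal_gen n fs"
  shows "homogeneous_part d p \<in> ideal_gen n fs"
proof -
  obtain g where g: "p = (\<Sum>j<length fs. g j * fs ! j)" "\<forall>j<length fs. g j \<in> coord_ring n"
    using assms(2) unfolding ideal_gen_def by auto
  define h where "h j = (if ds ! j \<le> d then homogeneous_part (d - ds ! j) (g j) else 0)" for j
  have "homogeneous_part d (g j * fs ! j) = h j * fs ! j" if "j < length fs" for j
    using homogeneous_part_mult_form[of "g j" n "fs ! j" "ds ! j" d] assms(1) g(2) that by (simp add: h_def)
  then have "homogeneous_part d p = (\<Sum>j<length fs. h j * fs ! j)"
    unfolding g(1) homogeneous_part_sum by simp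
  moreover have "\<forall>j<length fs. h j \<in> coord_ring n"
    using g(2) by (auto simp: h_def coord_ring_0 intro: forms_imp_coord_ring[OF homogeneous_part_in_forms])
  ultimately show ?thesis unfolding ideal_gen_def by auto
qed

text \<open>In degree \<open>d\<close> the ideal grows by the multiples of the new generator by forms of degree \<open>d - deg\<close>.
Taking homogeneous components of an arbitrary representation \<open>p + g f\<close> shows that forms suffice; this
is where homogeneity of all generators enters.\<close>

lemma ideal_gen_take_Suc_forms:
  assumes fs: "\<forall>i<length fs. fs ! i \<in> forms n (ds ! i)" and i: "i < length fs"
  shows "ideal_gen n (take (Suc i) fs) \<inter> forms n d =
    (if ds ! i \<le> d
     then {u + fs ! i * v | u v. u \<in> ideal_gen n (take i fs) \<inter> forms n d \<and> v \<in> forms n (d - ds ! i)}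
     else ideal_gen n (take i fs) \<inter> forms n d)" (is "?L = ?R")
proof
  have fi: "fs ! i \<in> forms n (ds ! i)" using fs i by blast
  have fs': "\<forall>j<length (take i fs). take i fs ! j \<in> forms n (ds ! j)" using fs i by auto
  show "?L \<subseteq> ?R"
  proof
    fix x assume x: "x \<in> ?L"
    then obtain p g where pg: "x = p + g * fs ! i" "p \<in> ideal_gen n (take i fs)" "g \<in> coord_ring n"
      using ideal_gen_take_Suc[OF i] by blast
    have p: "homogeneous_part d p \<in> ideal_gen n (take i fs)" using homogeneous_part_ideal_gen[OF fs' pg(2)] .
    have "fs ! j \<in> coord_ring n" if "j < length fs" for j
      using fs that forms_imp_coord_ring by blast
    then have "p \<in> coord_ring n"
      using pg(2) i unfolding ideal_gen_def by (auto intro!: coord_ring_sum coord_ring_mult)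
    then have p': "homogeneous_part d p \<in> forms n d" by (rule homogeneous_part_in_forms)
    have "x = homogeneous_part d x" using x homogeneous_part_forms by fastforce
    also have "\<dots> = homogeneous_part d p + (if ds ! i \<le> d then homogeneous_part (d - ds ! i) g * fs ! i else 0)"
      unfolding pg(1) homogeneous_part_add homogeneous_part_mult_form[OF pg(3) fi] ..
    finally have x': "x = homogeneous_part d p + (if ds ! i \<le> d then fs ! i * homogeneous_part (d - ds ! i) g else 0)"
      by (simp add: mult.commute)
    show "x \<in> ?R"
    proof (cases "ds ! i \<le> d")
      case True
      then have "x = homogeneous_part d p + fs ! i * homogeneous_part (d - ds ! i) g" using x' by simp
      then show ?thesis using True p p' homogeneous_part_in_forms[OF pg(3)] by auto
    next
      case False
      then show ?thesis using x' p p' by simp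
    qed
  qed
  show "?R \<subseteq> ?L"
  proof
    fix x assume x: "x \<in> ?R"
    show "x \<in> ?L"
    proof (cases "ds ! i \<le> d")
      case True
      then obtain u v where uv: "x = u + fs ! i * v" "u \<in> ideal_gen n (take i fs)" "u \<in> forms n d"
        "v \<in> forms n (d - ds ! i)" using x by auto
      then have "fs ! i * v \<in> forms n d" using forms_mult[OF fi uv(4)] True by simp
      then have "x \<in> forms n d" using uv mpoly.subspace_add[OF subspace_forms] by blast
      moreover have "x \<in> ideal_gen n (take (Suc i) fs)"
      proof -
        have "x = u + v * fs ! i" using uv(1) by (simp only: mult.commute)
        then show ?thesis
          unfolding ideal_gen_take_Suc[OF i] using uv(2) forms_imp_coord_ring[OF uv(4)] by blast
      qed
      ultimately show ?thesis by blast
    next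
      case False
      moreover have "p + 0 * fs ! i \<in> ideal_gen n (take (Suc i) fs)" if "p \<in> ideal_gen n (take i fs)" for p
        unfolding ideal_gen_take_Suc[OF i] using that coord_ring_0 by blast
      ultimately show ?thesis using x by auto
    qed
  qed
qed

section \<open>The Hilbert function modulo a regular form\<close>

definition monomials :: "nat \<Rightarrow> nat \<Rightarrow> (nat \<Rightarrow>\<^sub>0 nat) set" where
  "monomials n d = {m. Poly_Mapping.keys m \<subseteq> {..n} \<and> mono_degree m = d}"

text \<open>Stars and bars: the exponent vector of a monomial is a list of length \<open>n + 1\<close> with sum \<open>d\<close>.\<close>

lemma card_monomials: "finite (monomials n d) \<and> card (monomials n d) = (d + n) choose n"
proof -
  let ?L = "{l::nat list. length l = Suc n \<and> sum_list l = d}"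
  have inj: "inj_on (\<lambda>m. map (Poly_Mapping.lookup m) [0..<Suc n]) (monomials n d)"
  proof (rule inj_onI)
    fix m m' assume m: "m \<in> monomials n d" "m' \<in> monomials n d"
      and eq: "map (Poly_Mapping.lookup m) [0..<Suc n] = map (Poly_Mapping.lookup m') [0..<Suc n]"
    show "m = m'"
    proof (rule poly_mapping_eqI)
      fix k
      show "Poly_Mapping.lookup m k = Poly_Mapping.lookup m' k"
      proof (cases "k \<le> n")
        case True
        then show ?thesis using eq by (auto simp del: upt_Suc)
      next
        case False
        then have "k \<notin> Poly_Mapping.keys m" "k \<notin> Poly_Mapping.keys m'" using m by (auto simp: monomials_def)
        then show ?thesis by (simp add: in_keys_iff)
      qed
    qed
  qed
  have img: "(\<lambda>m. map (Poly_Mapping.lookup m) [0..<Suc n]) ` monomials n d = ?L"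
  proof
    have "sum_list (map (Poly_Mapping.lookup m) [0..<Suc n]) = d" if "m \<in> monomials n d" for m
    proof -
      have "sum_list (map (Poly_Mapping.lookup m) [0..<Suc n]) = (\<Sum>i\<in>{..n}. Poly_Mapping.lookup m i)"
        by (simp add: interv_sum_list_conv_sum_set_nat atLeast0LessThan lessThan_Suc_atMost del: upt_Suc)
      then show ?thesis using that mono_degree_eq_sum[of "{..n}" m] by (simp add: monomials_def)
    qed
    then show "(\<lambda>m. map (Poly_Mapping.lookup m) [0..<Suc n]) ` monomials n d \<subseteq> ?L" by auto
    show "?L \<subseteq> (\<lambda>m. map (Poly_Mapping.lookup m) [0..<Suc n]) ` monomials n d"
    proof
      fix l assume l: "l \<in> ?L"
      define m where "m = Poly_Mapping.nth l"
      have lk: "Poly_Mapping.lookup m i = (if i < Suc n then l ! i else 0)" for i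
        using l by (simp add: m_def nth.rep_eq nth_default_def)
      have k: "Poly_Mapping.keys m \<subseteq> {..n}" by (auto simp: in_keys_iff lk split: if_splits)
      have ml: "map (Poly_Mapping.lookup m) [0..<Suc n] = l"
        using l by (intro nth_equalityI) (auto simp: lk simp del: upt_Suc)
      have "mono_degree m = sum_list l"
        unfolding ml[symmetric] by (simp add: mono_degree_eq_sum[OF _ k] interv_sum_list_conv_sum_set_nat atLeast0LessThan lessThan_Suc_atMost del: upt_Suc)
      then have "m \<in> monomials n d" using l k ml by (simp add: monomials_def)
      then show "l \<in> (\<lambda>m. map (Poly_Mapping.lookup m) [0..<Suc n]) ` monomials n d" using ml by (metis image_eqI)
    qed
  qed
  have cL: "card ?L = (d + n) choose n"
    using card_length_sum_list[of "Suc n" d] binomial_symmetric[of d "d + n"] by simp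
  have "card ?L > 0" unfolding cL by simp
  then have "finite ?L" by (rule card_ge_0_finite)
  then show ?thesis using inj img cL by (metis (no_types, lifting) card_image finite_imageD)
qed

lemma forms_eq_span: "forms n d = mpoly.span ((\<lambda>m. Poly_Mapping.single m 1) ` monomials n d :: 'k::field mpoly set)"
proof
  let ?S = "(\<lambda>m. Poly_Mapping.single m 1) ` monomials n d :: 'k mpoly set"
  have "?S \<subseteq> forms n d" by (auto simp: forms_def coord_ring_def monomials_def)
  then show "mpoly.span ?S \<subseteq> forms n d" using subspace_forms mpoly.span_minimal by blast
  show "forms n d \<subseteq> mpoly.span ?S"
  proof
    fix p :: "'k mpoly" assume p: "p \<in> forms n d"
    have "p = (\<Sum>m\<in>Poly_Mapping.keys p. scal (Poly_Mapping.lookup p m) (Poly_Mapping.single m 1))"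
    proof (rule poly_mapping_eqI)
      fix k
      have "(\<Sum>m\<in>Poly_Mapping.keys p. Poly_Mapping.lookup p m * (1 when m = k))
         = (\<Sum>m\<in>Poly_Mapping.keys p. if m = k then Poly_Mapping.lookup p m else 0)"
        by (rule sum.cong) (auto simp: when_def)
      then show "Poly_Mapping.lookup p k = Poly_Mapping.lookup (\<Sum>m\<in>Poly_Mapping.keys p. scal (Poly_Mapping.lookup p m) (Poly_Mapping.single m 1)) k"
        by (simp add: lookup_sum lookup_single in_keys_iff)
    qed
    moreover have "m \<in> monomials n d" if "m \<in> Poly_Mapping.keys p" for m
      using p that by (auto simp: forms_def coord_ring_def monomials_def)
    ultimately show "p \<in> mpoly.span ?S"
      by (metis (no_types, lifting) image_eqI mpoly.span_base mpoly.span_scale mpoly.span_sum)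
  qed
qed

lemma independent_monomials:
  "mpoly.independent ((\<lambda>m. Poly_Mapping.single m 1) ` M :: 'k::field mpoly set)"
proof -
  have "(Poly_Mapping.single m 1 :: 'k mpoly) \<notin> mpoly.span ((\<lambda>m. Poly_Mapping.single m 1) ` M - {Poly_Mapping.single m 1})" for m
  proof
    let ?Z = "{p :: 'k mpoly. Poly_Mapping.lookup p m = 0}"
    assume a: "(Poly_Mapping.single m 1 :: 'k mpoly) \<in> mpoly.span ((\<lambda>m. Poly_Mapping.single m 1) ` M - {Poly_Mapping.single m 1})"
    have "mpoly.subspace ?Z" by (simp add: mpoly.subspace_def lookup_add)
    moreover have "(\<lambda>m. Poly_Mapping.single m 1) ` M - {Poly_Mapping.single m 1} \<subseteq> ?Z"
      by (auto simp: lookup_single when_def)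
    ultimately have "(Poly_Mapping.single m 1 :: 'k mpoly) \<in> ?Z" using a mpoly.span_minimal by blast
    then show False by simp
  qed
  then show ?thesis by (auto simp: mpoly.dependent_def)
qed

lemma dim_forms: "mpoly.dim (forms n d :: 'k::field mpoly set) = (d + n) choose n"
proof -
  have "inj_on (\<lambda>m. Poly_Mapping.single m 1 :: 'k mpoly) (monomials n d)"
    by (rule inj_onI) (metis lookup_single_eq lookup_single_not_eq zero_neq_one)
  then show ?thesis
    unfolding forms_eq_span mpoly.dim_span
    by (simp add: mpoly.dim_eq_card_independent independent_monomials card_image card_monomials)
qed

text \<open>The subtraction of natural numbers in \<open>hilbert_function\<close> does not truncate, because a subspace of the
forms has at most their dimension. So one can compute with the Hilbert function in the integers.\<close>

lemma hilbert_function_conv: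
  fixes I :: "'k::field mpoly set"
  assumes "mpoly.subspace I"
  shows "int (hilbert_function n I d) = int (mpoly.dim (forms n d :: 'k mpoly set)) - int (mpoly.dim (I \<inter> forms n d))"
proof -
  obtain B where B: "B \<subseteq> I \<inter> forms n d" "mpoly.independent B" "card B = mpoly.dim (I \<inter> forms n d)"
    by (rule mpoly.basis_exists)
  have "card B \<le> card ((\<lambda>m. Poly_Mapping.single m 1) ` monomials n d :: 'k mpoly set)"
    using mpoly.independent_span_bound[of "(\<lambda>m. Poly_Mapping.single m 1) ` monomials n d" B] B card_monomials
    by (simp add: forms_eq_span)
  also have "\<dots> = mpoly.dim (forms n d :: 'k mpoly set)"
    unfolding forms_eq_span mpoly.dim_span
    by (simp add: mpoly.dim_eq_card_independent independent_monomials)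
  finally show ?thesis using B unfolding hilbert_function_def by simp
qed

text \<open>The exact sequence \<open>0 \<rightarrow> (R/I)(-a) \<rightarrow> R/I \<rightarrow> R/(I, f) \<rightarrow> 0\<close> in degree \<open>d\<close>: regularity of \<open>f\<close> says that
multiplication by \<open>f\<close> pulls the ideal back to itself, which identifies the kernel in the rank--nullity
formula.\<close>

lemma hilbert_function_take_Suc:
  fixes fs :: "'k::field mpoly list"
  assumes fs: "\<forall>i<length fs. fs ! i \<in> forms n (ds ! i)" and i: "i < length fs"
    and reg: "\<forall>g\<in>coord_ring n. g * fs ! i \<in> ideal_gen n (take i fs) \<longrightarrow> g \<in> ideal_gen n (take i fs)"
  shows "int (hilbert_function n (ideal_gen n (take (Suc i) fs)) d) =
    int (hilbert_function n (ideal_gen n (take i fs)) d)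
    - (if ds ! i \<le> d then int (hilbert_function n (ideal_gen n (take i fs)) (d - ds ! i)) else 0)"
proof (cases "ds ! i \<le> d")
  case False
  then show ?thesis
    using ideal_gen_take_Suc_forms[OF fs i, of d] by (simp add: hilbert_function_def)
next
  case True
  let ?I = "ideal_gen n (take i fs)" and ?a = "ds ! i"
  let ?U = "?I \<inter> forms n d" and ?V = "forms n (d - ?a) :: 'k mpoly set"
  let ?M = "\<lambda>d. (\<lambda>m. Poly_Mapping.single m 1) ` monomials n d :: 'k mpoly set"
  have fi: "fs ! i \<in> forms n ?a" using fs i by blast
  have lin: "Vector_Spaces.linear scal scal (\<lambda>v. fs ! i * v)"
    by unfold_locales (simp_all add: scal_conv_mult algebra_simps)
  have K: "{v \<in> ?V. fs ! i * v \<in> ?U} = ?I \<inter> forms n (d - ?a)"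
  proof -
    have "fs ! i * v \<in> ?U \<longleftrightarrow> v \<in> ?I" if v: "v \<in> ?V" for v
    proof
      assume "fs ! i * v \<in> ?U"
      then show "v \<in> ?I" using reg forms_imp_coord_ring[OF v] by (simp add: mult.commute)
    next
      assume "v \<in> ?I"
      then have "fs ! i * v \<in> ?I" using ideal_gen_mult forms_imp_coord_ring[OF fi] by blast
      moreover have "fs ! i * v \<in> forms n d" using forms_mult[OF fi v] True by simp
      ultimately show "fs ! i * v \<in> ?U" by blast
    qed
    then show ?thesis by blast
  qed
  have fin: "finite (?M e)" for e using card_monomials by blast
  have "mpoly.dim {u + fs ! i * v | u v. u \<in> ?U \<and> v \<in> ?V} + mpoly.dim {v \<in> ?V. fs ! i * v \<in> ?U}
      = mpoly.dim ?U + mpoly.dim ?V"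
    by (rule mpoly.dim_plus_linear_image[OF lin _ _ fin _ fin])
      (auto simp: forms_eq_span subspace_ideal_gen intro: mpoly.subspace_inter)
  then have "mpoly.dim (ideal_gen n (take (Suc i) fs) \<inter> forms n d) + mpoly.dim (?I \<inter> forms n (d - ?a))
      = mpoly.dim ?U + mpoly.dim ?V"
    using ideal_gen_take_Suc_forms[OF fs i, of d] True K by simp
  then show ?thesis
    using True by (simp add: hilbert_function_conv subspace_ideal_gen)
qed

section \<open>Products of exponentials and power sums\<close>

definition psum :: "nat \<Rightarrow> 'a::comm_semiring_1 list \<Rightarrow> 'a" where
  "psum k xs = (\<Sum>x\<leftarrow>xs. x ^ k)"

lemma psum_simps [simp]: "psum k [] = 0" "psum k (x # xs) = x ^ k + psum k xs"
  by (simp_all add: psum_def)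

text \<open>The unit part \<open>(e\<^sup>a\<^sup>x - 1) / x\<close> of \<open>e\<^sup>a\<^sup>x - 1\<close>, with constant term \<open>a\<close>.\<close>

definition exp_shift :: "'a::field_char_0 \<Rightarrow> 'a fps" where
  "exp_shift a = fps_shift 1 (fps_exp a - 1)"

lemma exp_shift_nth: "exp_shift a $ k = a ^ (k + 1) / fact (k + 1)"
  by (simp add: exp_shift_def algebra_simps)

lemma fps_exp_conv_shift: "1 - fps_exp a = - fps_X * exp_shift a"
proof -
  have "fps_X * exp_shift a = fps_exp a - 1"
    by (rule fps_ext) (auto simp: exp_shift_def)
  then show ?thesis by simp
qed

text \<open>The logarithmic derivative \<open>x G' / G\<close> of \<open>G = (e\<^sup>x - 1) / x\<close>, that is \<open>x / (1 - e\<^sup>-\<^sup>x) - 1\<close>. Its coefficient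
of \<open>x ^ k\<close> is the Bernoulli number \<open>B\<^sub>k\<close> (with \<open>B\<^sub>1 = 1/2\<close>) divided by \<open>k!\<close> for \<open>k > 0\<close>, so it vanishes at the odd
\<open>k > 1\<close>. This is why odd power sums other than the first are invisible to the Hilbert polynomial.\<close>

definition log_deriv_exp :: "'a::field_char_0 fps" where
  "log_deriv_exp = fps_X * fps_deriv (exp_shift 1) * inverse (exp_shift 1)"

lemma log_deriv_exp_mult: "log_deriv_exp * exp_shift 1 = fps_X * fps_deriv (exp_shift (1 :: 'a::field_char_0))"
proof -
  have "exp_shift (1::'a) $ 0 \<noteq> 0" by (simp add: exp_shift_nth)
  then show ?thesis by (simp add: log_deriv_exp_def mult.assoc inverse_mult_eq_1)
qed

text \<open>Read off one after the other from the convolution identity \<open>log_deriv_exp * G = x G'\<close>.\<close>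

lemma log_deriv_exp_nth:
  defines "g \<equiv> fps_nth (log_deriv_exp :: rat fps)"
  shows "g 0 = 0" "g 1 = 1/2" "g 2 = 1/12" "g 3 = 0" "g 4 = - 1/720" "g 5 = 0"
    "g 6 = 1/30240" "g 7 = 0" "g 8 = - 1/1209600"
proof -
  have rec: "(\<Sum>i=0..k. g i * (1 / fact (k - i + 1))) = of_nat k / fact (k + 1)" for k
  proof -
    have "(\<Sum>i=0..k. g i * (1 / fact (k - i + 1))) = (log_deriv_exp * exp_shift (1::rat)) $ k"
      by (simp add: fps_mult_nth exp_shift_nth g_def)
    also have "\<dots> = of_nat k / fact (k + 1)"
      unfolding log_deriv_exp_mult by (cases k) (simp_all add: exp_shift_nth)
    finally show ?thesis .
  qed
  show g0: "g 0 = 0" using rec[of 0] by simp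
  show g1: "g 1 = 1/2" using rec[of 1] g0 by (simp add: eval_nat_numeral)
  show g2: "g 2 = 1/12" using rec[of 2] g0 g1 by (simp add: eval_nat_numeral field_simps; linarith)
  show g3: "g 3 = 0" using rec[of 3] g0 g1 g2 by (simp add: eval_nat_numeral field_simps; linarith)
  show g4: "g 4 = - 1/720" using rec[of 4] g0 g1 g2 g3 by (simp add: eval_nat_numeral field_simps; linarith)
  show g5: "g 5 = 0" using rec[of 5] g0 g1 g2 g3 g4 by (simp add: eval_nat_numeral field_simps; linarith)
  show g6: "g 6 = 1/30240" using rec[of 6] g0 g1 g2 g3 g4 g5 by (simp add: eval_nat_numeral field_simps; linarith)
  show g7: "g 7 = 0" using rec[of 7] g0 g1 g2 g3 g4 g5 g6 by (simp add: eval_nat_numeral field_simps; linarith)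
  show "g 8 = - 1/1209600" using rec[of 8] g0 g1 g2 g3 g4 g5 g6 g7 by (simp add: eval_nat_numeral field_simps; linarith)
qed

text \<open>Rescaling \<open>x\<close> to \<open>a x\<close> in the previous logarithmic derivative.\<close>

lemma log_deriv_exp_shift:
  "fps_X * fps_deriv (exp_shift a) = Abs_fps (\<lambda>k. log_deriv_exp $ k * a ^ k) * exp_shift (a :: 'a::field_char_0)"
proof (rule fps_ext)
  fix k
  have e: "exp_shift a $ j = a * a ^ j * (exp_shift 1 $ j)" for j
    by (simp add: exp_shift_nth)
  have "(fps_X * fps_deriv (exp_shift a)) $ k = a * a ^ k * ((fps_X * fps_deriv (exp_shift (1::'a))) $ k)"
    by (cases k) (simp_all add: e del: fps_const_mult)
  also have "\<dots> = (\<Sum>i=0..k. a * a ^ k * (log_deriv_exp $ i * exp_shift 1 $ (k - i)))"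
    unfolding log_deriv_exp_mult[symmetric] fps_mult_nth sum_distrib_left ..
  also have "\<dots> = (\<Sum>i=0..k. log_deriv_exp $ i * a ^ i * exp_shift a $ (k - i))"
  proof (rule sum.cong[OF refl])
    fix i assume "i \<in> {0..k}"
    then have "a ^ k = a ^ i * a ^ (k - i)" by (simp flip: power_add)
    then show "a * a ^ k * (log_deriv_exp $ i * exp_shift 1 $ (k - i)) = log_deriv_exp $ i * a ^ i * exp_shift a $ (k - i)"
      by (simp add: e)
  qed
  finally show "(fps_X * fps_deriv (exp_shift a)) $ k = (Abs_fps (\<lambda>k. log_deriv_exp $ k * a ^ k) * exp_shift a) $ k"
    by (simp add: fps_mult_nth)
qed

definition exp_prod :: "'a::field_char_0 list \<Rightarrow> 'a fps" where
  "exp_prod as = (\<Prod>a\<leftarrow>as. exp_shift a)"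

lemma exp_prod_nth_0: "exp_prod as $ 0 = prod_list as"
  by (induction as) (simp_all add: exp_prod_def exp_shift_nth)

text \<open>Logarithmic derivatives add up over products, which turns the product into power sums.\<close>

lemma log_deriv_exp_prod:
  "fps_X * fps_deriv (exp_prod as) = Abs_fps (\<lambda>k. log_deriv_exp $ k * psum k as) * exp_prod as"
proof (induction as)
  case Nil
  show ?case by (simp add: exp_prod_def fps_eq_iff fps_mult_nth)
next
  case (Cons a as)
  let ?h = "\<lambda>as. Abs_fps (\<lambda>k. log_deriv_exp $ k * psum k as)"
  have h: "?h (a # as) = Abs_fps (\<lambda>k. log_deriv_exp $ k * a ^ k) + ?h as"
    by (simp add: fps_eq_iff distrib_left)
  have "fps_X * fps_deriv (exp_prod (a # as)) =
      (fps_X * fps_deriv (exp_shift a)) * exp_prod as + exp_shift a * (fps_X * fps_deriv (exp_prod as))"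
    by (simp add: exp_prod_def algebra_simps)
  also have "\<dots> = ?h (a # as) * exp_prod (a # as)"
    unfolding Cons.IH log_deriv_exp_shift h by (simp add: exp_prod_def algebra_simps)
  finally show ?case .
qed

lemma prod_one_minus_exp: "(\<Prod>a\<leftarrow>as. 1 - fps_exp a) = (- fps_X) ^ length as * exp_prod as"
  by (induction as) (simp_all add: exp_prod_def fps_exp_conv_shift algebra_simps)

text \<open>A power series is determined by its constant term and its logarithmic derivative, order by order:
the coefficient \<open>j\<close> of \<open>x U' = h U\<close> reads \<open>j U\<^sub>j = h\<^sub>j U\<^sub>0 + \<dots>\<close> with earlier coefficients only, and it can be
solved for \<open>h\<^sub>j\<close> as well as, since \<open>h\<^sub>0 = 0\<close>, for \<open>U\<^sub>j\<close>.\<close>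

lemma log_deriv_agree:
  fixes U V h k :: "'a::field_char_0 fps"
  assumes U: "fps_X * fps_deriv U = h * U" and V: "fps_X * fps_deriv V = k * V"
    and nz: "U $ 0 \<noteq> 0" and h0: "h $ 0 = 0" "k $ 0 = 0"
  shows "(\<forall>j\<le>m. U $ j = V $ j) \<longleftrightarrow> U $ 0 = V $ 0 \<and> (\<forall>j\<le>m. h $ j = k $ j)"
proof -
  have rec: "of_nat j * F $ j = f $ j * F $ 0 + (\<Sum>i<j. f $ i * F $ (j - i))"
    if "fps_X * fps_deriv F = f * F" for F f :: "'a fps" and j
  proof -
    have "of_nat j * F $ j = (fps_X * fps_deriv F) $ j" by (cases j) simp_all
    also have "\<dots> = (\<Sum>i\<le>j. f $ i * F $ (j - i))" unfolding that by (simp add: fps_mult_nth atLeast0AtMost)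
    also have "\<dots> = f $ j * F $ 0 + (\<Sum>i<j. f $ i * F $ (j - i))"
      by (simp flip: lessThan_Suc_atMost)
    finally show ?thesis .
  qed
  show ?thesis
  proof (intro iffI conjI)
    assume a: "\<forall>j\<le>m. U $ j = V $ j"
    then show 0: "U $ 0 = V $ 0" by simp
    have "j \<le> m \<longrightarrow> h $ j = k $ j" for j
    proof (induction j rule: less_induct)
      case (less j)
      show ?case
      proof
        assume j: "j \<le> m"
        have "(\<Sum>i<j. h $ i * U $ (j - i)) = (\<Sum>i<j. k $ i * V $ (j - i))"
          using a j less.IH by (intro sum.cong) auto
        then have "h $ j * U $ 0 = k $ j * U $ 0"
          using rec[OF U, of j] rec[OF V, of j] a[rule_format, OF j] 0 by (simp only: add_right_cancel)
        then show "h $ j = k $ j" using nz by simp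
      qed
    qed
    then show "\<forall>j\<le>m. h $ j = k $ j" by blast
  next
    assume a: "U $ 0 = V $ 0 \<and> (\<forall>j\<le>m. h $ j = k $ j)"
    have "j \<le> m \<longrightarrow> U $ j = V $ j" for j
    proof (induction j rule: less_induct)
      case (less j)
      show ?case
      proof
        assume j: "j \<le> m"
        show "U $ j = V $ j"
        proof (cases "j = 0")
          case True
          then show ?thesis using a by simp
        next
          case False
          have "(\<Sum>i<j. h $ i * U $ (j - i)) = (\<Sum>i<j. k $ i * V $ (j - i))"
          proof (rule sum.cong[OF refl])
            fix i assume "i \<in> {..<j}"
            then show "h $ i * U $ (j - i) = k $ i * V $ (j - i)"
              using a j less.IH h0 by (cases "i = 0") auto
          qed
          then have "of_nat j * U $ j = of_nat j * V $ j"
            using rec[OF U, of j] rec[OF V, of j] a j by simp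
          then show ?thesis using False by simp
        qed
      qed
    qed
    then show "\<forall>j\<le>m. U $ j = V $ j" by blast
  qed
qed

section \<open>Contact of products of \<open>1 - x ^ a\<close> at \<open>x = 1\<close>\<close>

text \<open>The numerator of the Hilbert series, whose denominator is \<open>(1 - x) ^ (n + 1)\<close>.\<close>

definition hilbert_numerator :: "nat list \<Rightarrow> 'a::comm_ring_1 poly" where
  "hilbert_numerator as = (\<Prod>a\<leftarrow>as. 1 - monom 1 a)"

lemma pcompose_power: "pcompose (p ^ n) q = pcompose p q ^ n"
  by (induction n) (simp_all add: pcompose_1 pcompose_mult)

lemma pcompose_reflect: "pcompose (pcompose p [:1, -1:]) [:1, -1:] = (p :: 'a::comm_ring_1 poly)"
proof -
  have "pcompose [:1, -1:] [:1, -1::'a:] = [:0, 1:]" by (simp add: pcompose_pCons)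
  then show ?thesis by (simp flip: pcompose_assoc)
qed

lemma reflect_power_dvd:
  assumes "q ^ N dvd (p :: 'a::comm_ring_1 poly)"
  shows "pcompose q [:1, -1:] ^ N dvd pcompose p [:1, -1:]"
proof -
  obtain r where "p = q ^ N * r" using assms ..
  then show ?thesis by (simp add: pcompose_mult pcompose_power)
qed

lemma fps_low_coeffs_zero_iff: "(\<forall>k<N. F $ k = 0) \<longleftrightarrow> F = 0 \<or> N \<le> subdegree F"
proof
  assume a: "\<forall>k<N. F $ k = 0"
  show "F = 0 \<or> N \<le> subdegree F"
    using a nth_subdegree_nonzero[of F] by (meson leI)
next
  assume "F = 0 \<or> N \<le> subdegree F"
  then show "\<forall>k<N. F $ k = 0" using nth_less_subdegree_zero[of _ F] by auto
qed

text \<open>The substitution \<open>x = e\<^sup>s\<close> is a local coordinate change at \<open>x = 1\<close>, so it preserves the order of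
vanishing there. It is carried out in two steps, reflecting \<open>x\<close> to \<open>1 - x\<close> and then composing with the
series \<open>1 - e\<^sup>s\<close>, because composition of power series needs a vanishing constant term.\<close>

lemma pow_one_minus_dvd_iff:
  fixes p :: "'a::field_char_0 poly"
  shows "[:1, -1:] ^ N dvd p \<longleftrightarrow>
    (\<forall>k<N. (fps_of_poly (pcompose p [:1, -1:]) oo (1 - fps_exp 1)) $ k = 0)"
proof -
  let ?q = "pcompose p [:1, -1:]" and ?W = "1 - fps_exp 1 :: 'a fps"
  have W: "?W $ 0 = 0" by simp
  have refl: "pcompose [:1, -1:] [:1, -1::'a:] = [:0, 1:]" "pcompose [:0, 1:] [:1, -1::'a:] = [:1, -1:]"
    by (simp_all add: pcompose_pCons)
  have "[:1, -1:] ^ N dvd p \<longleftrightarrow> [:0, 1:] ^ N dvd ?q"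
    using reflect_power_dvd[of "[:1, -1:]" N p] reflect_power_dvd[of "[:0, 1:]" N ?q]
    by (auto simp: refl pcompose_reflect)
  also have "\<dots> \<longleftrightarrow> (\<forall>k<N. fps_of_poly ?q $ k = 0)"
    by (simp add: monom_altdef flip: monom_1_dvd_iff')
  also have "\<dots> \<longleftrightarrow> fps_of_poly ?q oo ?W = 0 \<or> N \<le> subdegree (fps_of_poly ?q oo ?W)"
  proof -
    have sW: "subdegree ?W = 1" by (rule subdegreeI) auto
    then have "?W \<noteq> 0" by (metis subdegree_0 zero_neq_one)
    then show ?thesis
      unfolding fps_low_coeffs_zero_iff subdegree_fps_compose[OF W] fps_compose_eq_0_iff[OF W] sW
      by (simp del: fps_compose_nth_0 cong: conj_cong)
  qed
  finally show ?thesis unfolding fps_low_coeffs_zero_iff .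
qed

lemma hilbert_numerator_Nil [simp]: "hilbert_numerator [] = 1"
  and hilbert_numerator_Cons: "hilbert_numerator (a # as) = (1 - monom 1 a) * hilbert_numerator as"
  by (simp_all add: hilbert_numerator_def)

lemma hilbert_numerator_compose_exp:
  "fps_of_poly (pcompose (hilbert_numerator as) [:1, -1:]) oo (1 - fps_exp 1)
    = (\<Prod>a\<leftarrow>as. 1 - fps_exp (of_nat a :: 'a::field_char_0))"
proof (induction as)
  case Nil
  show ?case by (simp add: pcompose_1)
next
  case (Cons a as)
  have W: "(1 - fps_exp 1 :: 'a fps) $ 0 = 0" by simp
  have "pcompose (1 - monom 1 a) [:1, -1:] = 1 - [:1, -1::'a:] ^ a"
    by (simp add: pcompose_diff pcompose_1 monom_altdef pcompose_power pcompose_pCons)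
  then have "fps_of_poly (pcompose (1 - monom 1 a) [:1, -1::'a:]) oo (1 - fps_exp 1)
      = 1 - ((1 - fps_X) oo (1 - fps_exp 1)) ^ a"
    by (simp add: fps_of_poly_diff fps_of_poly_power fps_of_poly_linear' fps_compose_sub_distrib
        flip: fps_const_neg fps_compose_power[OF W])
  also have "(1 - fps_X) oo (1 - fps_exp 1) = fps_exp (1::'a)"
    using fps_X_fps_compose_startby0[OF W] by (simp add: fps_compose_sub_distrib)
  also have "fps_exp (1::'a) ^ a = fps_exp (of_nat a)" by (simp add: fps_exp_power_mult)
  finally have 1: "fps_of_poly (pcompose (1 - monom 1 a) [:1, -1::'a:]) oo (1 - fps_exp 1) = 1 - fps_exp (of_nat a)" .
  show ?case
    unfolding hilbert_numerator_Cons pcompose_mult fps_of_poly_mult fps_compose_mult_distrib[OF W] 1 Cons.IH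
    by simp
qed

text \<open>The numerical content of equality of Hilbert polynomials of complete intersections of codimension
\<open>c\<close> in \<open>\<P>\<^sup>c\<^sup>+\<^sup>m\<close>. Under \<open>x = e\<^sup>s\<close> both numerators acquire the factor \<open>(-s) ^ c\<close>, so contact of order
\<open>c + m + 1\<close> compares the remaining factors up to order \<open>m\<close>: their constant terms are the products
of the degrees, and their logarithmic derivatives carry the power sums.\<close>

lemma hilbert_numerator_contact_iff:
  fixes as bs :: "nat list"
  assumes "length as = c" "length bs = c" "\<forall>a\<in>set as. 0 < a"
  shows "[:1, -1::rat:] ^ (c + m + 1) dvd hilbert_numerator as - hilbert_numerator bs \<longleftrightarrow>
    prod_list as = prod_list bs \<and>
    (\<forall>k\<le>m. (log_deriv_exp $ k :: rat) = 0 \<or> psum k as = psum k bs)"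
proof -
  let ?r = "map (of_nat :: nat \<Rightarrow> rat)"
  let ?U = "exp_prod (?r as)" and ?V = "exp_prod (?r bs)"
  have W: "(1 - fps_exp 1 :: rat fps) $ 0 = 0" by simp
  have prod: "prod_list (?r l) = of_nat (prod_list l)" for l by (induction l) simp_all
  have ps: "psum k (?r l) = of_nat (psum k l)" for k l by (induction l) simp_all
  have F: "fps_of_poly (pcompose (hilbert_numerator l) [:1, -1:]) oo (1 - fps_exp 1) = (- fps_X) ^ length l * exp_prod (?r l)" for l
    unfolding hilbert_numerator_compose_exp using prod_one_minus_exp[of "?r l"] by (simp add: comp_def)
  have pow: "(- fps_X :: rat fps) ^ c = fps_const ((-1) ^ c) * fps_X ^ c"
    by (subst power_minus) (simp flip: fps_const_neg fps_const_power)
  have "fps_of_poly (pcompose (hilbert_numerator as - hilbert_numerator bs) [:1, -1:]) oo (1 - fps_exp 1) = (- fps_X) ^ c * (?U - ?V)"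
    using F[of as] F[of bs] assms by (simp add: pcompose_diff fps_of_poly_diff fps_compose_sub_distrib algebra_simps)
  also have "\<dots> = fps_const ((-1) ^ c) * (fps_X ^ c * (?U - ?V))"
    unfolding pow by (simp only: mult.assoc)
  finally have E: "fps_of_poly (pcompose (hilbert_numerator as - hilbert_numerator bs) [:1, -1:]) oo (1 - fps_exp 1)
      = fps_const ((-1) ^ c) * (fps_X ^ c * (?U - ?V))" .
  have "[:1, -1::rat:] ^ (c + m + 1) dvd hilbert_numerator as - hilbert_numerator bs \<longleftrightarrow> (\<forall>k<c + m + 1. (fps_X ^ c * (?U - ?V)) $ k = 0)"
    unfolding pow_one_minus_dvd_iff E by simp
  also have "\<dots> \<longleftrightarrow> (\<forall>j\<le>m. ?U $ j = ?V $ j)"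
  proof
    assume a: "\<forall>k<c + m + 1. (fps_X ^ c * (?U - ?V)) $ k = 0"
    show "\<forall>j\<le>m. ?U $ j = ?V $ j"
    proof (intro allI impI)
      fix j assume "j \<le> m"
      then have "(fps_X ^ c * (?U - ?V)) $ (c + j) = 0" using a by simp
      then show "?U $ j = ?V $ j" by (simp add: fps_X_power_mult_nth)
    qed
  next
    assume "\<forall>j\<le>m. ?U $ j = ?V $ j"
    then show "\<forall>k<c + m + 1. (fps_X ^ c * (?U - ?V)) $ k = 0"
      by (auto simp: fps_X_power_mult_nth)
  qed
  also have "\<dots> \<longleftrightarrow> ?U $ 0 = ?V $ 0 \<and>
      (\<forall>j\<le>m. Abs_fps (\<lambda>k. log_deriv_exp $ k * psum k (?r as)) $ j = Abs_fps (\<lambda>k. log_deriv_exp $ k * psum k (?r bs)) $ j)"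
  proof (rule log_deriv_agree[OF log_deriv_exp_prod log_deriv_exp_prod])
    show "?U $ 0 \<noteq> 0" using assms(3) by (auto simp: exp_prod_nth_0 prod prod_list_zero_iff)
  qed (simp_all add: log_deriv_exp_nth)
  also have "\<dots> \<longleftrightarrow> prod_list as = prod_list bs \<and>
    (\<forall>k\<le>m. (log_deriv_exp $ k :: rat) = 0 \<or> psum k as = psum k bs)"
    by (simp add: exp_prod_nth_0 prod ps)
  finally show ?thesis .
qed

section \<open>Elementary symmetric functions\<close>

text \<open>The elementary symmetric functions, as the coefficients of \<open>\<Prod> (1 + x t)\<close>.\<close>

definition esym :: "nat \<Rightarrow> 'a::comm_ring_1 list \<Rightarrow> 'a" where
  "esym k xs = coeff (\<Prod>x\<leftarrow>xs. [:1, x:]) k"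

lemma esym_Nil [simp]: "esym 0 [] = 1" "k > 0 \<Longrightarrow> esym k [] = 0"
  by (simp_all add: esym_def)

lemma esym_0 [simp]: "esym 0 xs = 1"
  by (induction xs) (simp_all add: esym_def coeff_mult)

lemma esym_Cons_Suc: "esym (Suc k) (x # xs) = esym (Suc k) xs + x * esym k xs"
  by (simp add: esym_def)

lemma esym_Cons: "k > 0 \<Longrightarrow> esym k (x # xs) = esym k xs + x * esym (k - 1) xs"
  using esym_Cons_Suc[of "k - 1"] by simp

lemma esym_gt_length: "k > length xs \<Longrightarrow> esym k xs = 0"
proof (induction xs arbitrary: k)
  case (Cons x xs)
  then show ?case by (cases k) (simp_all add: esym_Cons_Suc)
qed simp

lemma esym_length: "esym (length xs) xs = prod_list xs"
  by (induction xs) (simp_all add: esym_Cons_Suc esym_gt_length)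

text \<open>The entries are recovered from the roots \<open>- 1 / x\<close> of \<open>\<Prod> (1 + x t)\<close>.\<close>

lemma esym_eq_imp_mset_eq:
  fixes xs ys :: "'a::field list"
  assumes eq: "\<And>k. esym k xs = esym k ys" and nz: "0 \<notin> set xs" "0 \<notin> set ys"
  shows "mset xs = mset ys"
proof -
  have pr: "proots (\<Prod>x\<leftarrow>zs. [:1, x:]) = image_mset (\<lambda>x. - inverse x) (mset zs)" if "0 \<notin> set zs" for zs :: "'a list"
    using that
  proof (induction zs)
    case (Cons z zs)
    have "[:1, z:] = smult z [:inverse z, 1:]" using Cons.prems by simp
    then have "proots [:1, z:] = {#- inverse z#}" using Cons.prems by (simp del: smult_pCons)
    moreover have "(\<Prod>x\<leftarrow>zs. [:1, x:]) \<noteq> 0" by (auto simp: prod_list_zero_iff)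
    ultimately show ?case using Cons by (simp add: proots_mult del: mult_pCons_left)
  qed simp
  have "(\<Prod>x\<leftarrow>xs. [:1, x:]) = (\<Prod>y\<leftarrow>ys. [:1, y:])"
    using eq by (intro poly_eqI) (simp add: esym_def)
  then have "image_mset (\<lambda>x. - inverse x) (mset xs) = image_mset (\<lambda>x. - inverse x) (mset ys)"
    using pr[OF nz(1)] pr[OF nz(2)] by simp
  then have "image_mset (\<lambda>x. - inverse x) (image_mset (\<lambda>x. - inverse x) (mset xs))
     = image_mset (\<lambda>x. - inverse x) (image_mset (\<lambda>x. - inverse x) (mset ys))" by simp
  then show ?thesis by (simp add: multiset.map_comp comp_def)
qed

lemma esym_Cons_numeral:
  "esym 1 (x # xs) = esym 1 xs + x"
  "esym 2 (x # xs) = esym 2 xs + x * esym 1 xs"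
  "esym 3 (x # xs) = esym 3 xs + x * esym 2 xs"
  "esym 4 (x # xs) = esym 4 xs + x * esym 3 xs"
  "esym 5 (x # xs) = esym 5 xs + x * esym 4 xs"
  "esym 6 (x # xs) = esym 6 xs + x * esym 5 xs"
  "esym 7 (x # xs) = esym 7 xs + x * esym 6 xs"
  "esym 8 (x # xs) = esym 8 xs + x * esym 7 xs"
  by (simp_all add: esym_Cons)

text \<open>Newton's identities in the first four degrees. Each one follows by induction on the list, using the
preceding ones for the shorter list.\<close>

lemma newton_identities:
  fixes xs :: "'a::idom list"
  shows newton_1: "psum 1 xs = esym 1 xs"
    and newton_2: "2 * esym 2 xs = esym 1 xs * psum 1 xs - psum 2 xs"
    and newton_3: "3 * esym 3 xs = esym 2 xs * psum 1 xs - esym 1 xs * psum 2 xs + psum 3 xs"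
    and newton_4: "4 * esym 4 xs = esym 3 xs * psum 1 xs - esym 2 xs * psum 2 xs + esym 1 xs * psum 3 xs - psum 4 xs"
proof -
  have 1: "psum 1 xs = esym 1 xs" for xs :: "'a list"
    by (induction xs) (simp_all add: esym_Cons)
  have 2: "2 * esym 2 xs = esym 1 xs * psum 1 xs - psum 2 xs" for xs :: "'a list"
  proof (induction xs)
    case (Cons x xs)
    show ?case unfolding esym_Cons_numeral psum_simps using Cons 1[of xs] by algebra
  qed simp
  have 3: "3 * esym 3 xs = esym 2 xs * psum 1 xs - esym 1 xs * psum 2 xs + psum 3 xs" for xs :: "'a list"
  proof (induction xs)
    case (Cons x xs)
    show ?case unfolding esym_Cons_numeral psum_simps using Cons 1[of xs] 2[of xs] by algebra
  qed simp
  have 4: "4 * esym 4 xs = esym 3 xs * psum 1 xs - esym 2 xs * psum 2 xs + esym 1 xs * psum 3 xs - psum 4 xs" for xs :: "'a list"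
  proof (induction xs)
    case (Cons x xs)
    show ?case unfolding esym_Cons_numeral psum_simps using Cons 1[of xs] 2[of xs] 3[of xs] by algebra
  qed simp
  show "psum 1 xs = esym 1 xs" "2 * esym 2 xs = esym 1 xs * psum 1 xs - psum 2 xs"
    "3 * esym 3 xs = esym 2 xs * psum 1 xs - esym 1 xs * psum 2 xs + psum 3 xs"
    "4 * esym 4 xs = esym 3 xs * psum 1 xs - esym 2 xs * psum 2 xs + esym 1 xs * psum 3 xs - psum 4 xs"
    using 1 2 3 4 by blast+
qed

text \<open>The coefficients of \<open>\<Prod> (1 - x\<^sup>2 t\<^sup>2) = \<Prod> (1 + x t) \<Prod> (1 - x t)\<close>. They connect even power sums, which are power
sums of the squares, with the elementary symmetric functions of the entries themselves.\<close>

lemma esym_squares: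
  fixes xs :: "'a::idom list"
  defines "e \<equiv> \<lambda>k. esym k xs" and "q \<equiv> \<lambda>k. esym k (map (\<lambda>x. x\<^sup>2) xs)"
  shows "q 1 = (e 1)\<^sup>2 - 2 * e 2"
    and "q 2 = (e 2)\<^sup>2 - 2 * e 1 * e 3 + 2 * e 4"
    and "q 3 = (e 3)\<^sup>2 - 2 * e 2 * e 4 + 2 * e 1 * e 5 - 2 * e 6"
    and "q 4 = (e 4)\<^sup>2 - 2 * e 3 * e 5 + 2 * e 2 * e 6 - 2 * e 1 * e 7 + 2 * e 8"
proof -
  let ?q = "\<lambda>k xs. esym k (map (\<lambda>x. x\<^sup>2) xs)"
  have 1: "?q 1 xs = (esym 1 xs)\<^sup>2 - 2 * esym 2 xs" for xs :: "'a list"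
  proof (induction xs)
    case (Cons x xs)
    show ?case unfolding list.map esym_Cons_numeral using Cons by algebra
  qed simp
  have 2: "?q 2 xs = (esym 2 xs)\<^sup>2 - 2 * esym 1 xs * esym 3 xs + 2 * esym 4 xs" for xs :: "'a list"
  proof (induction xs)
    case (Cons x xs)
    show ?case unfolding list.map esym_Cons_numeral using Cons 1[of xs] by algebra
  qed simp
  have 3: "?q 3 xs = (esym 3 xs)\<^sup>2 - 2 * esym 2 xs * esym 4 xs + 2 * esym 1 xs * esym 5 xs - 2 * esym 6 xs" for xs :: "'a list"
  proof (induction xs)
    case (Cons x xs)
    show ?case unfolding list.map esym_Cons_numeral using Cons 2[of xs] by algebra
  qed simp
  have 4: "?q 4 xs = (esym 4 xs)\<^sup>2 - 2 * esym 3 xs * esym 5 xs + 2 * esym 2 xs * esym 6 xs - 2 * esym 1 xs * esym 7 xs + 2 * esym 8 xs" for xs :: "'a list"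
  proof (induction xs)
    case (Cons x xs)
    show ?case unfolding list.map esym_Cons_numeral using Cons 3[of xs] by algebra
  qed simp
  show "q 1 = (e 1)\<^sup>2 - 2 * e 2"
    and "q 2 = (e 2)\<^sup>2 - 2 * e 1 * e 3 + 2 * e 4"
    and "q 3 = (e 3)\<^sup>2 - 2 * e 2 * e 4 + 2 * e 1 * e 5 - 2 * e 6"
    and "q 4 = (e 4)\<^sup>2 - 2 * e 3 * e 5 + 2 * e 2 * e 6 - 2 * e 1 * e 7 + 2 * e 8"
    unfolding q_def e_def using 1 2 3 4 by blast+
qed

lemma psum_squares: "psum k (map (\<lambda>x. x\<^sup>2) xs) = psum (2 * k) xs"
  by (simp add: psum_def comp_def power_mult)

lemma esym_squares_cong:
  fixes xs ys :: "'a::field_char_0 list"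
  defines "q \<equiv> \<lambda>k xs. esym k (map (\<lambda>x. x\<^sup>2) (xs :: 'a list))"
  shows "psum 2 xs = psum 2 ys \<Longrightarrow> q 1 xs = q 1 ys"
    and "psum 2 xs = psum 2 ys \<Longrightarrow> psum 4 xs = psum 4 ys \<Longrightarrow> q 2 xs = q 2 ys"
    and "psum 2 xs = psum 2 ys \<Longrightarrow> psum 4 xs = psum 4 ys \<Longrightarrow> psum 6 xs = psum 6 ys \<Longrightarrow> q 3 xs = q 3 ys"
    and "psum 2 xs = psum 2 ys \<Longrightarrow> psum 4 xs = psum 4 ys \<Longrightarrow> psum 6 xs = psum 6 ys \<Longrightarrow> psum 8 xs = psum 8 ys
      \<Longrightarrow> q 4 xs = q 4 ys"
proof -
  let ?s = "map (\<lambda>x. x\<^sup>2) :: 'a list \<Rightarrow> 'a list"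
  have p: "psum 1 (?s l) = psum 2 l" "psum 2 (?s l) = psum 4 l" "psum 3 (?s l) = psum 6 l" "psum 4 (?s l) = psum 8 l" for l
    by (simp_all add: psum_squares)
  note N = newton_identities[of "?s xs", unfolded p] newton_identities[of "?s ys", unfolded p]
  show 1: "q 1 xs = q 1 ys" if "psum 2 xs = psum 2 ys"
    using N(1,5) that by (simp add: q_def)
  show 2: "q 2 xs = q 2 ys" if "psum 2 xs = psum 2 ys" "psum 4 xs = psum 4 ys"
  proof -
    have "2 * q 2 xs = 2 * q 2 ys" using N(2,6) 1 that unfolding q_def by simp
    then show ?thesis by simp
  qed
  show 3: "q 3 xs = q 3 ys" if "psum 2 xs = psum 2 ys" "psum 4 xs = psum 4 ys" "psum 6 xs = psum 6 ys"
  proof -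
    have "3 * q 3 xs = 3 * q 3 ys" using N(3,7) 1 2 that unfolding q_def by simp
    then show ?thesis by simp
  qed
  show "q 4 xs = q 4 ys" if "psum 2 xs = psum 2 ys" "psum 4 xs = psum 4 ys" "psum 6 xs = psum 6 ys" "psum 8 xs = psum 8 ys"
  proof -
    have "4 * q 4 xs = 4 * q 4 ys" using N(4,8) 1 2 3 that unfolding q_def by simp
    then show ?thesis by simp
  qed
qed

section \<open>Inequalities for elementary symmetric functions of positive numbers\<close>

lemma esym_nonneg:
  fixes xs :: "'a::linordered_idom list"
  assumes "\<forall>x\<in>set xs. 0 < x" shows "0 \<le> esym k xs"
  using assms
proof (induction xs arbitrary: k)
  case Nil
  then show ?case by (cases k) simp_all
next
  case (Cons x xs)
  then show ?case by (cases k) (simp_all add: esym_Cons_Suc)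
qed

lemma esym_pos:
  fixes xs :: "'a::linordered_idom list"
  assumes "\<forall>x\<in>set xs. 0 < x" "k \<le> length xs" shows "0 < esym k xs"
  using assms
proof (induction xs arbitrary: k)
  case (Cons x xs)
  then show ?case
  proof (cases k)
    case (Suc j)
    then have "0 < x * esym j xs" using Cons by simp
    then show ?thesis using Suc esym_nonneg[of xs "Suc j"] Cons.prems by (simp add: esym_Cons_Suc)
  qed simp
qed simp

text \<open>Weak forms of Newton's inequalities, with constants that do not depend on the number of entries.\<close>

lemma esym_inequalities:
  fixes xs :: "'a::linordered_idom list"
  assumes "\<forall>x\<in>set xs. 0 < x"
  shows esym_ineq_3: "3 * esym 3 xs \<le> esym 1 xs * esym 2 xs"
    and esym_ineq_5: "2 * (esym 1 xs * esym 4 xs) \<le> esym 2 xs * esym 3 xs"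
proof -
  \<comment> \<open>Appending \<open>x\<close> turns each difference into a polynomial in \<open>x\<close> whose coefficients are controlled
    by the other differences, so the induction needs two more inequalities.\<close>
  have "2 * esym 2 xs \<le> (esym 1 xs)\<^sup>2 \<and> 3 * esym 3 xs \<le> esym 1 xs * esym 2 xs \<and>
    esym 1 xs * esym 3 xs + 2 * esym 4 xs \<le> (esym 2 xs)\<^sup>2 \<and>
    2 * (esym 1 xs * esym 4 xs) \<le> esym 2 xs * esym 3 xs"
    using assms
  proof (induction xs)
    case (Cons x xs)
    define e1 e2 e3 e4 where e: "e1 = esym 1 xs" "e2 = esym 2 xs" "e3 = esym 3 xs" "e4 = esym 4 xs"
    have x: "0 < x" using Cons by simp
    have nn: "0 \<le> e1" "0 \<le> e2" "0 \<le> e3" "0 \<le> e4" using esym_nonneg[of xs] Cons.prems by (simp_all add: e)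
    have I: "2 * e2 \<le> e1\<^sup>2" "3 * e3 \<le> e1 * e2" "e1 * e3 + 2 * e4 \<le> e2\<^sup>2" "2 * (e1 * e4) \<le> e2 * e3"
      using Cons by (simp_all add: e)
    have c: "esym 1 (x # xs) = e1 + x" "esym 2 (x # xs) = e2 + x * e1"
      "esym 3 (x # xs) = e3 + x * e2" "esym 4 (x # xs) = e4 + x * e3"
      by (simp_all add: esym_Cons e)
    have d1: "(e1 + x)\<^sup>2 - 2 * (e2 + x * e1) = (e1\<^sup>2 - 2 * e2) + x * x"
      by (simp add: algebra_simps power2_eq_square)
    have d2: "(e1 + x) * (e2 + x * e1) - 3 * (e3 + x * e2)
        = (e1 * e2 - 3 * e3) + x * (e1\<^sup>2 - 2 * e2) + x * x * e1"
      by (simp add: algebra_simps power2_eq_square)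
    have d3: "(e2 + x * e1)\<^sup>2 - ((e1 + x) * (e3 + x * e2) + 2 * (e4 + x * e3))
        = (e2\<^sup>2 - (e1 * e3 + 2 * e4)) + x * (e1 * e2 - 3 * e3) + x * x * (e1\<^sup>2 - e2)"
      by (simp add: algebra_simps power2_eq_square)
    have d4: "(e2 + x * e1) * (e3 + x * e2) - 2 * ((e1 + x) * (e4 + x * e3))
        = (e2 * e3 - 2 * (e1 * e4)) + x * (e2\<^sup>2 - (e1 * e3 + 2 * e4)) + x * x * (e1 * e2 - 2 * e3)"
      by (simp add: algebra_simps power2_eq_square)
    have "0 \<le> e1\<^sup>2 - 2 * e2" "0 \<le> e1 * e2 - 3 * e3" "0 \<le> e2\<^sup>2 - (e1 * e3 + 2 * e4)"
      "0 \<le> e2 * e3 - 2 * (e1 * e4)" "0 \<le> e1\<^sup>2 - e2" "0 \<le> e1 * e2 - 2 * e3"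
      using I nn by linarith+
    then have "0 \<le> (e1\<^sup>2 - 2 * e2) + x * x"
      "0 \<le> (e1 * e2 - 3 * e3) + x * (e1\<^sup>2 - 2 * e2) + x * x * e1"
      "0 \<le> (e2\<^sup>2 - (e1 * e3 + 2 * e4)) + x * (e1 * e2 - 3 * e3) + x * x * (e1\<^sup>2 - e2)"
      "0 \<le> (e2 * e3 - 2 * (e1 * e4)) + x * (e2\<^sup>2 - (e1 * e3 + 2 * e4)) + x * x * (e1 * e2 - 2 * e3)"
      using x nn by (intro add_nonneg_nonneg mult_nonneg_nonneg; simp)+
    then show ?case unfolding c d1[symmetric] d2[symmetric] d3[symmetric] d4[symmetric]
      by (simp only: le_diff_eq add_0 simp_thms)
  qed simp
  then show "3 * esym 3 xs \<le> esym 1 xs * esym 2 xs"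
    "2 * (esym 1 xs * esym 4 xs) \<le> esym 2 xs * esym 3 xs" by blast+
qed

text \<open>The third Hurwitz determinant of \<open>\<Prod> (1 + x t)\<close>, a polynomial all of whose roots are real and negative,
is positive. Here \<open>e\<^sub>1 e\<^sub>2 e\<^sub>3\<close> beats \<open>e\<^sub>3\<^sup>2\<close> by a factor of three and \<open>e\<^sub>1\<^sup>2 e\<^sub>4\<close> by a factor of two, and
\<open>1/3 + 1/2 < 1\<close>.\<close>

lemma hurwitz_determinant_pos:
  fixes xs :: "'a::linordered_field list"
  assumes pos: "\<forall>x\<in>set xs. 0 < x" and len: "5 \<le> length xs"
  shows "0 < esym 1 xs * esym 2 xs * esym 3 xs - (esym 3 xs)\<^sup>2 - (esym 1 xs)\<^sup>2 * esym 4 xs + esym 1 xs * esym 5 xs"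
proof -
  define e1 e2 e3 e4 e5 where e: "e1 = esym 1 xs" "e2 = esym 2 xs" "e3 = esym 3 xs" "e4 = esym 4 xs" "e5 = esym 5 xs"
  have p: "0 < e1" "0 < e2" "0 < e3" "0 < e5" using esym_pos[OF pos] len by (simp_all add: e)
  have "e3 * (3 * e3) \<le> e3 * (e1 * e2)" "e1 * (2 * (e1 * e4)) \<le> e1 * (e2 * e3)"
    using p esym_ineq_3[OF pos] esym_ineq_5[OF pos] unfolding e by (intro mult_left_mono; simp)+
  then have "3 * e3\<^sup>2 \<le> e1 * e2 * e3" "2 * (e1\<^sup>2 * e4) \<le> e1 * e2 * e3"
    by (simp_all add: algebra_simps power2_eq_square)
  moreover have "0 < e1 * e5" "0 < e1 * e2 * e3" using p by simp_all
  ultimately show ?thesis unfolding e[symmetric] by linarith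
qed

text \<open>For six entries, \<open>e\<^sub>1\<close>, \<open>e\<^sub>2\<close>, \<open>e\<^sub>6\<close> are known and the even power sums give three quadratic equations for
\<open>e\<^sub>3\<close>, \<open>e\<^sub>4\<close>, \<open>e\<^sub>5\<close>. The differences of two solutions satisfy a linear system whose coefficients are those of
the midpoint of the solutions and whose determinant is a multiple of the Hurwitz determinant there.
That determinant is concave in \<open>(e\<^sub>3, e\<^sub>4, e\<^sub>5)\<close>, hence positive at the midpoint if it is so at both ends.\<close>

lemma esym_eq_of_hurwitz_pos:
  fixes e1 e2 e3 e4 e5 e6 f3 f4 f5 :: "'a::linordered_field"
  assumes q2: "e2\<^sup>2 - 2 * e1 * e3 + 2 * e4 = e2\<^sup>2 - 2 * e1 * f3 + 2 * f4"
    and q3: "e3\<^sup>2 - 2 * e2 * e4 + 2 * e1 * e5 - 2 * e6 = f3\<^sup>2 - 2 * e2 * f4 + 2 * e1 * f5 - 2 * e6"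
    and q4: "e4\<^sup>2 - 2 * e3 * e5 + 2 * e2 * e6 = f4\<^sup>2 - 2 * f3 * f5 + 2 * e2 * e6"
    and e1: "0 < e1"
    and De: "0 < e1 * e2 * e3 - e3\<^sup>2 - e1\<^sup>2 * e4 + e1 * e5" (is "0 < ?De")
    and Df: "0 < e1 * e2 * f3 - f3\<^sup>2 - e1\<^sup>2 * f4 + e1 * f5" (is "0 < ?Df")
  shows "e3 = f3 \<and> e4 = f4 \<and> e5 = f5"
proof -
  \<comment> \<open>The second factor is four times the Hurwitz determinant at the midpoint.\<close>
  have "(e3 - f3) * (2 * ?De + 2 * ?Df + (e3 - f3)\<^sup>2) = 0"
    using q2 q3 q4 by algebra
  moreover have "2 * ?De + 2 * ?Df + (e3 - f3)\<^sup>2 > 0" 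
    by (rule add_pos_nonneg[OF add_pos_pos[OF mult_pos_pos[OF zero_less_numeral De]
        mult_pos_pos[OF zero_less_numeral Df]] zero_le_power2])
  ultimately have 3: "e3 = f3" by simp
  then have 4: "e4 = f4" using q2 by simp
  then have "e1 * e5 = e1 * f5" using 3 q3 by simp
  then show ?thesis using 3 4 e1 by simp
qed

text \<open>Uniqueness for every pair \<open>(c, m)\<close> needed: product and first power sum are \<open>e\<^sub>c\<close> and \<open>e\<^sub>1\<close>, the second power
sum adds \<open>e\<^sub>2\<close>, and the higher even ones yield the missing \<open>e\<^sub>k\<close>. For \<open>c = 4\<close> this needs \<open>e\<^sub>1 > 0\<close>, for \<open>c = 5\<close>
the inequality \<open>e\<^sub>1 e\<^sub>2 > e\<^sub>3\<close>, and for \<open>c = 6\<close> the third Hurwitz determinant.\<close>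

lemma mset_eq_of_psums:
  fixes xs ys :: "'a::linordered_field list"
  assumes px: "\<forall>x\<in>set xs. 0 < x" and py: "\<forall>y\<in>set ys. 0 < y"
    and lx: "length xs = c" and ly: "length ys = c"
    and cm: "(c, m) \<in> {(1, 0), (2, 1), (3, 2), (4, 4), (5, 6), (6, 8)}"
    and prod: "prod_list xs = prod_list ys"
    and ps: "\<And>k. k \<in> {1, 2, 4, 6, 8} \<Longrightarrow> k \<le> m \<Longrightarrow> psum k xs = psum k ys"
  shows "mset xs = mset ys"
proof -
  define e f where e: "e = (\<lambda>k. esym k xs)" and f: "f = (\<lambda>k. esym k ys)"
  have z: "e k = 0" "f k = 0" if "k > c" for k using that lx ly by (simp_all add: e f esym_gt_length)
  have pos: "0 < e k" "0 < f k" if "k \<le> c" for k using that lx ly px py by (simp_all add: e f esym_pos)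
  have top: "e c = f c" using prod lx ly esym_length[of xs] esym_length[of ys] by (simp add: e f)
  have h1: "e 1 = f 1" if "1 \<le> m" using ps[of 1] newton_1[of xs] newton_1[of ys] that by (simp add: e f)
  have h2: "e 2 = f 2" if "2 \<le> m"
  proof -
    have "2 * e 2 = 2 * f 2"
      using newton_2[of xs] newton_2[of ys] newton_1[of xs] newton_1[of ys] ps[of 1] ps[of 2] that
      by (simp add: e f)
    then show ?thesis by simp
  qed
  note sx = esym_squares[of xs, folded e] and sy = esym_squares[of ys, folded f]
  note sq = esym_squares_cong[of xs ys]
  have q2: "(e 2)\<^sup>2 - 2 * e 1 * e 3 + 2 * e 4 = (f 2)\<^sup>2 - 2 * f 1 * f 3 + 2 * f 4" if "4 \<le> m"
    using sx(2) sy(2) sq(2) ps[of 2] ps[of 4] that by (simp add: e f)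
  have q3: "(e 3)\<^sup>2 - 2 * e 2 * e 4 + 2 * e 1 * e 5 - 2 * e 6 = (f 3)\<^sup>2 - 2 * f 2 * f 4 + 2 * f 1 * f 5 - 2 * f 6" if "6 \<le> m"
    using sx(3) sy(3) sq(3) ps[of 2] ps[of 4] ps[of 6] that by (simp add: e f)
  have q4: "(e 4)\<^sup>2 - 2 * e 3 * e 5 + 2 * e 2 * e 6 - 2 * e 1 * e 7 + 2 * e 8 = (f 4)\<^sup>2 - 2 * f 3 * f 5 + 2 * f 2 * f 6 - 2 * f 1 * f 7 + 2 * f 8" if "8 \<le> m"
    using sx(4) sy(4) sq(4) ps[of 2] ps[of 4] ps[of 6] ps[of 8] that by (simp add: e f)
  have low: "\<forall>k\<in>{1, 2, 3, 4, 5}. k < c \<longrightarrow> e k = f k"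
    using cm unfolding insert_iff empty_iff prod.inject simp_thms
  proof (elim disjE conjE)
    assume c: "c = 4" "m = 4"
    then have "e 1 * e 3 = e 1 * f 3" using q2 h1 h2 top by simp
    then have "e 3 = f 3" using pos(1)[of 1] c by simp
    then show ?thesis using c h1 h2 by simp
  next
    assume c: "c = 5" "m = 6"
    have top5: "e 5 = f 5" "e 6 = 0" "f 6 = 0" using top z c by simp_all
    have "(e 2)\<^sup>2 - 2 * e 1 * e 3 + 2 * e 4 = (e 2)\<^sup>2 - 2 * e 1 * f 3 + 2 * f 4"
      "(e 3)\<^sup>2 - 2 * e 2 * e 4 = (f 3)\<^sup>2 - 2 * e 2 * f 4"
      using q2 q3 h1 h2 top5 c by simp_all
    then have "(e 3 - f 3) * (e 3 + f 3 - 2 * (e 1 * e 2)) = 0" by algebra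
    moreover have "e 3 + f 3 - 2 * (e 1 * e 2) < 0"
      using esym_ineq_3[OF px] esym_ineq_3[OF py] pos[of 3] h1 h2 c by (simp add: e f)
    ultimately have "e 3 = f 3" by simp
    then have "e 4 = f 4" using q2 h1 h2 c by simp
    then show ?thesis using \<open>e 3 = f 3\<close> c h1 h2 by simp
  next
    assume c: "c = 6" "m = 8"
    have top6: "e 6 = f 6" "e 7 = 0" "e 8 = 0" "f 7 = 0" "f 8 = 0" using top z c by simp_all
    have "e 3 = f 3 \<and> e 4 = f 4 \<and> e 5 = f 5"
      by (rule esym_eq_of_hurwitz_pos[of "e 2" "e 1" "e 3" "e 4" "f 3" "f 4" "e 5" "e 6" "f 5"])
        (use q2 q3 q4 h1 h2 top6 c pos(1)[of 1] hurwitz_determinant_pos[OF px] hurwitz_determinant_pos[OF py] lx ly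
          in \<open>simp_all add: e f\<close>)
    then show ?thesis using c h1 h2 by simp
  qed (use h1 h2 in simp_all)
  have "e k = f k" for k
  proof -
    consider "k = 0" | "k = c" | "k > c" | "k < c" "0 < k" by linarith
    then show ?thesis
    proof cases
      case 4
      then have "k \<in> {1, 2, 3, 4, 5}" using cm by auto
      then show ?thesis using low 4 by blast
    qed (use top z in \<open>simp_all add: e f\<close>)
  qed
  then show ?thesis using px py by (intro esym_eq_imp_mset_eq) (auto simp: e f)
qed

section \<open>Hilbert series and Hilbert polynomials\<close>

definition binomial_series :: "nat \<Rightarrow> rat fps" where
  "binomial_series n = Abs_fps (\<lambda>d. of_nat ((d + n) choose n))"

lemma binomial_series_mult: "(1 - fps_X) ^ Suc n * binomial_series n = 1"
proof (induction n)
  case 0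
  have "(1 - fps_X) * binomial_series 0 = 1"
  proof (rule fps_ext)
    show "((1 - fps_X) * binomial_series 0) $ d = (1 :: rat fps) $ d" for d
      by (cases d) (simp_all add: binomial_series_def left_diff_distrib)
  qed
  then show ?case by simp
next
  case (Suc n)
  have "(1 - fps_X) * binomial_series (Suc n) = binomial_series n"
  proof (rule fps_ext)
    show "((1 - fps_X) * binomial_series (Suc n)) $ d = binomial_series n $ d" for d
      by (cases d) (simp_all add: binomial_series_def left_diff_distrib)
  qed
  then have "(1 - fps_X) ^ Suc (Suc n) * binomial_series (Suc n) = (1 - fps_X) ^ Suc n * binomial_series n"
    by (metis power_Suc2 mult.assoc)
  then show ?case using Suc by (simp only:)
qed

lemma hilbert_numerator_append: "hilbert_numerator (as @ bs) = hilbert_numerator as * hilbert_numerator bs"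
  by (induction as) (simp_all add: hilbert_numerator_Cons mult.assoc)

text \<open>Each generator of degree \<open>a\<close> multiplies the Hilbert series by \<open>1 - x\<^sup>a\<close>.\<close>

lemma hilbert_series_complete_intersection:
  assumes "complete_intersection n ds (I :: 'k::field mpoly set)"
  shows "Abs_fps (\<lambda>d. of_nat (hilbert_function n I d)) = fps_of_poly (hilbert_numerator ds) * binomial_series n"
proof -
  obtain fs where fs: "length fs = length ds" "\<forall>i<length fs. fs ! i \<in> forms n (ds ! i)"
    "regular_sequence n fs" "I = ideal_gen n fs"
    using assms unfolding complete_intersection_def by auto
  let ?H = "\<lambda>i. Abs_fps (\<lambda>d. of_nat (hilbert_function n (ideal_gen n (take i fs)) d)) :: rat fps"
  have "?H i = fps_of_poly (hilbert_numerator (take i ds)) * binomial_series n" if "i \<le> length fs" for i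
    using that
  proof (induction i)
    case 0
    have "({0} :: 'k mpoly set) \<inter> forms n d = {0}" for d
      using mpoly.subspace_0[OF subspace_forms] by blast
    moreover have "mpoly.dim ({0} :: 'k mpoly set) = 0"
      by (rule mpoly.dim_unique[of "{}"]) (auto simp: mpoly.span_empty mpoly.independent_empty)
    ultimately show ?case
      by (simp add: ideal_gen_Nil hilbert_function_def dim_forms binomial_series_def)
  next
    case (Suc i)
    then have i: "i < length fs" by simp
    let ?a = "ds ! i"
    have reg: "\<forall>g\<in>coord_ring n. g * fs ! i \<in> ideal_gen n (take i fs) \<longrightarrow> g \<in> ideal_gen n (take i fs)"
      using fs(3) i unfolding regular_sequence_def by blast
    have "?H (Suc i) = (1 - fps_X ^ ?a) * ?H i"
    proof (rule fps_ext)
      fix d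
      have "rat_of_int (int (hilbert_function n (ideal_gen n (take (Suc i) fs)) d)) =
          rat_of_int (int (hilbert_function n (ideal_gen n (take i fs)) d)
          - (if ?a \<le> d then int (hilbert_function n (ideal_gen n (take i fs)) (d - ?a)) else 0))"
        using hilbert_function_take_Suc[OF fs(2) i reg, of d] by simp
      then show "?H (Suc i) $ d = ((1 - fps_X ^ ?a) * ?H i) $ d"
        by (auto simp: left_diff_distrib fps_X_power_mult_nth)
    qed
    moreover have "take (Suc i) ds = take i ds @ [?a]" using i fs(1) by (simp add: take_Suc_conv_app_nth)
    ultimately show ?case
      using Suc i by (simp add: hilbert_numerator_append hilbert_numerator_Cons fps_of_poly_mult fps_of_poly_diff fps_of_poly_monom' mult_ac)
  qed
  from this[of "length fs"] show ?thesis using fs by simp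
qed

lemma binomial_series_polynomial:
  "\<exists>P. \<forall>d. poly P (of_nat d) = binomial_series n $ d"
proof -
  let ?P = "smult (1 / fact n) (\<Prod>i\<in>{0..<n}. [:1 + of_nat i, 1:]) :: rat poly"
  have "poly ?P (of_nat d) = binomial_series n $ d" for d
  proof -
    have "of_nat ((d + n) choose n) = (of_nat (d + n) :: rat) gchoose n" by (rule binomial_gbinomial)
    also have "\<dots> = pochhammer (of_nat d + 1) n / fact n" by (simp add: gbinomial_pochhammer')
    finally show ?thesis
      by (simp add: binomial_series_def pochhammer_prod poly_prod add_ac)
  qed
  then show ?thesis by blast
qed

lemma eventually_polynomial_mult_binomial_series:
  "\<exists>P d0. \<forall>d\<ge>d0. poly P (of_nat d) = (fps_of_poly A * binomial_series n) $ d"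
proof (induction A)
  case 0
  show ?case by (rule exI[of _ 0]) simp
next
  case (pCons a A)
  obtain P d0 where P: "\<forall>d\<ge>d0. poly P (of_nat d) = (fps_of_poly A * binomial_series n) $ d"
    using pCons by blast
  obtain Q where Q: "\<forall>d. poly Q (of_nat d) = binomial_series n $ d"
    using binomial_series_polynomial by blast
  have "poly (smult a Q + pcompose P [:-1, 1:]) (of_nat d) = (fps_of_poly (pCons a A) * binomial_series n) $ d"
    if d: "d \<ge> Suc d0" for d
  proof -
    obtain e where e: "d = Suc e" using Suc_le_D[OF d] by blast
    have "(fps_of_poly (pCons a A) * binomial_series n) $ d = a * binomial_series n $ d + (fps_of_poly A * binomial_series n) $ e"
      by (simp add: fps_of_poly_pCons distrib_right mult.assoc e fps_mult_left_const_nth mult.commute[of _ fps_X])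
    moreover have "poly Q (1 + of_nat e) = binomial_series n $ Suc e" using Q[rule_format, of "Suc e"] by simp
    ultimately show ?thesis using P e d by (simp add: poly_pcompose)
  qed
  then show ?case by blast
qed

text \<open>The definite description is legitimate: the coefficients of the Hilbert series are eventually
polynomial, and two polynomials with infinitely many common values coincide.\<close>

lemma hilbert_polynomial_spec:
  assumes "complete_intersection n ds (I :: 'k::field mpoly set)"
  shows "\<exists>d0. \<forall>d\<ge>d0. poly (hilbert_polynomial n I) (of_nat d) = of_nat (hilbert_function n I d)"
proof -
  let ?S = "\<lambda>P. \<exists>d0. \<forall>d\<ge>d0. poly P (of_nat d) = rat_of_nat (hilbert_function n I d)"
  obtain P where P: "?S P"
    using eventually_polynomial_mult_binomial_series[of "hilbert_numerator ds" n]
    by (auto simp flip: hilbert_series_complete_intersection[OF assms])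
  have "Q = P" if SQ: "?S Q" for Q
  proof (rule ccontr)
    assume "Q \<noteq> P"
    then have fin: "finite {x. poly (Q - P) x = 0}" by (intro poly_roots_finite) simp
    obtain d1 where d1: "\<forall>d\<ge>d1. poly P (of_nat d) = rat_of_nat (hilbert_function n I d)"
      using P by (elim exE)
    obtain d2 where d2: "\<forall>d\<ge>d2. poly Q (of_nat d) = rat_of_nat (hilbert_function n I d)"
      using SQ by (elim exE)
    have "of_nat ` {max d1 d2..} \<subseteq> {x. poly (Q - P) x = 0}" using d1 d2 by auto
    then have "finite ((of_nat :: nat \<Rightarrow> rat) ` {max d1 d2..})" using fin finite_subset by blast
    then have "finite {max d1 d2..}" by (rule finite_imageD) (simp add: inj_on_def)
    then show False using infinite_Ici by blast
  qed
  then have "\<exists>!P. ?S P" using P by blast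
  then show ?thesis unfolding hilbert_polynomial_def by (rule theI')
qed

text \<open>Hilbert polynomials agree exactly if the Hilbert functions agree in all large degrees, that is, if the
difference of the Hilbert series is a polynomial; multiplying by \<open>(1 - x) ^ (n + 1)\<close> turns this into
divisibility of the difference of the numerators.\<close>

theorem hilbert_polynomial_eq_iff:
  assumes X: "complete_intersection n as (X :: 'k::field mpoly set)"
    and Y: "complete_intersection n bs (Y :: 'k mpoly set)"
  shows "hilbert_polynomial n X = hilbert_polynomial n Y \<longleftrightarrow> [:1, -1::rat:] ^ Suc n dvd hilbert_numerator as - hilbert_numerator bs"
proof -
  define D where "D = fps_of_poly (hilbert_numerator as - hilbert_numerator bs) * binomial_series n"
  have D: "D $ d = of_nat (hilbert_function n X d) - of_nat (hilbert_function n Y d)" for d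
    unfolding D_def fps_of_poly_diff left_diff_distrib
      hilbert_series_complete_intersection[OF X, symmetric] hilbert_series_complete_intersection[OF Y, symmetric]
    by simp
  have DB: "(1 - fps_X) ^ Suc n * D = fps_of_poly (hilbert_numerator as - hilbert_numerator bs)"
    unfolding D_def using binomial_series_mult[of n] by (simp add: mult_ac)
  have lin: "fps_of_poly ([:1, -1::rat:] ^ Suc n) = (1 - fps_X) ^ Suc n"
    by (simp only: fps_of_poly_power) (simp add: fps_of_poly_linear' flip: fps_const_neg)
  show ?thesis
  proof
    assume eq: "hilbert_polynomial n X = hilbert_polynomial n Y"
    obtain d1 where d1: "\<forall>d\<ge>d1. poly (hilbert_polynomial n X) (of_nat d) = rat_of_nat (hilbert_function n X d)"
      using hilbert_polynomial_spec[OF X] by (elim exE)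
    obtain d2 where d2: "\<forall>d\<ge>d2. poly (hilbert_polynomial n Y) (of_nat d) = rat_of_nat (hilbert_function n Y d)"
      using hilbert_polynomial_spec[OF Y] by (elim exE)
    then have z: "D $ d = 0" if "d \<ge> max d1 d2" for d
    proof -
      have "d1 \<le> d" "d2 \<le> d" using that by simp_all
      then have "rat_of_nat (hilbert_function n X d) = rat_of_nat (hilbert_function n Y d)"
        using d1 d2 eq by metis
      then show ?thesis by (simp add: D)
    qed
    have "fps_of_poly (truncate_fps (max d1 d2) D) = D"
      by (rule fps_ext) (use z in \<open>auto simp: coeff_truncate_fps not_less\<close>)
    then have "fps_of_poly ([:1, -1:] ^ Suc n * truncate_fps (max d1 d2) D) = fps_of_poly (hilbert_numerator as - hilbert_numerator bs)"
      unfolding fps_of_poly_mult lin using DB by simp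
    then show "[:1, -1::rat:] ^ Suc n dvd hilbert_numerator as - hilbert_numerator bs" by (metis fps_of_poly_eq_iff dvd_triv_left)
  next
    assume "[:1, -1::rat:] ^ Suc n dvd hilbert_numerator as - hilbert_numerator bs"
    then obtain R where R: "hilbert_numerator as - hilbert_numerator bs = [:1, -1::rat:] ^ Suc n * R" ..
    have "(1 - fps_X) ^ Suc n * D = (1 - fps_X) ^ Suc n * fps_of_poly R"
      using DB unfolding R fps_of_poly_mult lin .
    moreover have "(1 - fps_X :: rat fps) ^ Suc n \<noteq> 0" using binomial_series_mult[of n] by auto
    ultimately have "D = fps_of_poly R" by simp
    then have z: "hilbert_function n X d = hilbert_function n Y d" if "d > degree R" for d
      using D[of d] that by (simp add: coeff_eq_0)
    have "(\<exists>d0. \<forall>d\<ge>d0. poly P (of_nat d) = rat_of_nat (hilbert_function n X d)) \<longleftrightarrow>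
       (\<exists>d0. \<forall>d\<ge>d0. poly P (of_nat d) = rat_of_nat (hilbert_function n Y d))" for P
    proof (rule iffI; elim exE)
      fix d0 assume "\<forall>d\<ge>d0. poly P (of_nat d) = rat_of_nat (hilbert_function n X d)"
      then show "\<exists>d0. \<forall>d\<ge>d0. poly P (of_nat d) = rat_of_nat (hilbert_function n Y d)"
        using z by (intro exI[of _ "max d0 (Suc (degree R))"]) auto
    next
      fix d0 assume "\<forall>d\<ge>d0. poly P (of_nat d) = rat_of_nat (hilbert_function n Y d)"
      then show "\<exists>d0. \<forall>d\<ge>d0. poly P (of_nat d) = rat_of_nat (hilbert_function n X d)"
        using z by (intro exI[of _ "max d0 (Suc (degree R))"]) auto
    qed
    then show "hilbert_polynomial n X = hilbert_polynomial n Y" unfolding hilbert_polynomial_def by simp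
  qed
qed

section \<open>Monomial complete intersections\<close>

lemma lookup_mult_monomial:
  fixes g :: "'k::field mpoly"
  shows "Poly_Mapping.lookup (g * Poly_Mapping.single m0 1) (m + m0) = Poly_Mapping.lookup g m"
proof -
  have "Sum_any (\<lambda>q. (1 when m0 = q) when m + m0 = l + q) = (1 when m = l :: 'k)" for l
  proof -
    have h: "(\<lambda>q. (1 when m0 = q) when m + m0 = l + q) = (\<lambda>q. (1 when m = l :: 'k) when m0 = q)"
      by (auto simp: when_def)
    show ?thesis unfolding h by simp
  qed
  then show ?thesis by (simp add: lookup_mult lookup_single mult_when)
qed

lemma generator_in_ideal_gen:
  assumes "j < length fs"
  shows "fs ! j \<in> ideal_gen n fs"
proof -
  have "(\<Sum>i<length fs. (if i = j then 1 else 0) * fs ! i) = (\<Sum>i<length fs. if i = j then fs ! i else 0)"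
    by (rule sum.cong) auto
  also have "\<dots> = fs ! j" using assms by simp
  finally show ?thesis unfolding ideal_gen_def
    by (auto intro!: exI[of _ "\<lambda>i. if i = j then 1 else 0"] simp: coord_ring_0 coord_ring_1)
qed

lemma sum_monomials: "p = (\<Sum>m\<in>Poly_Mapping.keys p. Poly_Mapping.single m (Poly_Mapping.lookup p m))"
proof (rule poly_mapping_eqI)
  fix k
  show "Poly_Mapping.lookup p k = Poly_Mapping.lookup (\<Sum>m\<in>Poly_Mapping.keys p. Poly_Mapping.single m (Poly_Mapping.lookup p m)) k"
    by (simp add: lookup_sum lookup_single when_def in_keys_iff)
qed

text \<open>The monomials \<open>x\<^sub>0 ^ d\<^sub>0, x\<^sub>1 ^ d\<^sub>1, \<dots>\<close>, the simplest regular sequence with prescribed degrees.\<close>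

definition power_monomials :: "nat list \<Rightarrow> 'k::field mpoly list" where
  "power_monomials ds = map (\<lambda>i. Poly_Mapping.single (Poly_Mapping.single i (ds ! i)) 1) [0..<length ds]"

lemma power_monomials_nth:
  "i < length ds \<Longrightarrow> power_monomials ds ! i = Poly_Mapping.single (Poly_Mapping.single i (ds ! i)) 1"
  by (simp add: power_monomials_def)

lemma length_power_monomials [simp]: "length (power_monomials ds) = length ds"
  by (simp add: power_monomials_def)

lemma power_monomials_forms:
  "i < length ds \<Longrightarrow> length ds \<le> n \<Longrightarrow> power_monomials ds ! i \<in> forms n (ds ! i)"
  by (auto simp: power_monomials_nth forms_def coord_ring_def)

text \<open>All monomials of a product with \<open>x\<^sub>j ^ d\<^sub>j\<close> are divisible by \<open>x\<^sub>j ^ d\<^sub>j\<close>; conversely, a monomial divisible by a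
generator is a multiple of it, and a polynomial is the sum of its terms.\<close>

lemma mem_ideal_power_monomials:
  fixes p :: "'k::field mpoly"
  assumes i: "i \<le> length ds" and n: "length ds \<le> n"
  shows "p \<in> ideal_gen n (take i (power_monomials ds)) \<longleftrightarrow>
    p \<in> coord_ring n \<and> (\<forall>m\<in>Poly_Mapping.keys p. \<exists>j<i. ds ! j \<le> Poly_Mapping.lookup m j)"
proof
  let ?f = "\<lambda>j. Poly_Mapping.single (Poly_Mapping.single j (ds ! j)) 1 :: 'k mpoly"
  have fR: "?f j \<in> coord_ring n" if "j < i" for j
    using that i n by (auto simp: coord_ring_def)
  assume "p \<in> ideal_gen n (take i (power_monomials ds))"
  then obtain g where g: "p = (\<Sum>j<i. g j * ?f j)" "\<forall>j<i. g j \<in> coord_ring n"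
    using i by (auto simp: ideal_gen_def power_monomials_nth)
  have "p \<in> coord_ring n" unfolding g(1) using g(2) fR by (auto intro!: coord_ring_sum coord_ring_mult)
  moreover have "\<exists>j<i. ds ! j \<le> Poly_Mapping.lookup m j" if m: "m \<in> Poly_Mapping.keys p" for m
  proof -
    obtain j where j: "j < i" "m \<in> Poly_Mapping.keys (g j * ?f j)"
      using m Poly_Mapping.keys_sum[of "\<lambda>j. g j * ?f j" "{..<i}"] unfolding g(1) by auto
    then obtain a where "m = a + Poly_Mapping.single j (ds ! j)"
      using keys_mult[of "g j" "?f j"] by auto
    then show ?thesis using j(1) by (auto simp: lookup_add)
  qed
  ultimately show "p \<in> coord_ring n \<and> (\<forall>m\<in>Poly_Mapping.keys p. \<exists>j<i. ds ! j \<le> Poly_Mapping.lookup m j)" by blast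
next
  let ?I = "ideal_gen n (take i (power_monomials ds)) :: 'k mpoly set"
  assume p: "p \<in> coord_ring n \<and> (\<forall>m\<in>Poly_Mapping.keys p. \<exists>j<i. ds ! j \<le> Poly_Mapping.lookup m j)"
  have "Poly_Mapping.single m (Poly_Mapping.lookup p m) \<in> ?I" if m: "m \<in> Poly_Mapping.keys p" for m
  proof -
    obtain j where j: "j < i" "ds ! j \<le> Poly_Mapping.lookup m j" using p m by blast
    let ?mj = "Poly_Mapping.single j (ds ! j)"
    have split: "m = (m - ?mj) + ?mj"
      by (rule poly_mapping_eqI) (use j in \<open>auto simp: lookup_add lookup_minus lookup_single when_def\<close>)
    have "Poly_Mapping.keys (m - ?mj) \<subseteq> Poly_Mapping.keys m"
      by (auto simp: in_keys_iff lookup_minus)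
    then have "Poly_Mapping.single (m - ?mj) (Poly_Mapping.lookup p m) \<in> coord_ring n"
      using p m by (auto simp: coord_ring_def)
    moreover have "Poly_Mapping.single ?mj 1 \<in> ?I"
      using generator_in_ideal_gen[of j "take i (power_monomials ds :: 'k mpoly list)" n] j i
      by (simp add: power_monomials_nth)
    ultimately have "Poly_Mapping.single (m - ?mj) (Poly_Mapping.lookup p m) * Poly_Mapping.single ?mj 1 \<in> ?I"
      by (rule ideal_gen_mult)
    then show ?thesis unfolding mult_single using split by simp
  qed
  then have "(\<Sum>m\<in>Poly_Mapping.keys p. Poly_Mapping.single m (Poly_Mapping.lookup p m)) \<in> ?I"
    by (intro mpoly.subspace_sum subspace_ideal_gen)
  then show "p \<in> ?I" using sum_monomials[of p] by simp
qed

text \<open>Multiplying by a power of a variable that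
does not occur among the first \<open>i\<close> generators cannot move a polynomial into their ideal; applied to
\<open>x\<^sub>i\<close> this gives regularity, and applied to \<open>x\<^sub>n\<close> saturation. Thus every degree sequence of length at
most \<open>n\<close> occurs in \<open>\<P>\<^sup>n\<close>.\<close>

lemma complete_intersection_power_monomials:
  assumes pos: "\<forall>d\<in>set ds. 0 < d" and n: "length ds \<le> n"
  shows "complete_intersection n ds (ideal_gen n (power_monomials ds) :: 'k::field mpoly set)"
proof -
  let ?fs = "power_monomials ds :: 'k mpoly list"
  have shift: "g \<in> ideal_gen n (take i ?fs)"
    if i: "i \<le> length ds" and g: "g \<in> coord_ring n"
      and gm: "g * Poly_Mapping.single m0 1 \<in> ideal_gen n (take i ?fs)"
      and m0: "\<forall>j<i. Poly_Mapping.lookup m0 j = 0" for g i m0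
    unfolding mem_ideal_power_monomials[OF i n]
  proof (intro conjI g ballI)
    fix m assume m: "m \<in> Poly_Mapping.keys g"
    have "m + m0 \<in> Poly_Mapping.keys (g * Poly_Mapping.single m0 1)"
      using m by (simp add: in_keys_iff lookup_mult_monomial)
    then obtain j where "j < i" "ds ! j \<le> Poly_Mapping.lookup (m + m0) j"
      using gm unfolding mem_ideal_power_monomials[OF i n] by blast
    then show "\<exists>j<i. ds ! j \<le> Poly_Mapping.lookup m j" using m0 by (auto simp: lookup_add)
  qed
  have "1 \<notin> ideal_gen n ?fs"
  proof
    assume "1 \<in> ideal_gen n ?fs"
    then have "1 \<in> ideal_gen n (take (length ds) ?fs)" by simp
    then have "\<forall>m\<in>Poly_Mapping.keys (1 :: 'k mpoly). \<exists>j<length ds. ds ! j \<le> Poly_Mapping.lookup m j"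
      unfolding mem_ideal_power_monomials[OF order_refl n] by (rule conjunct2)
    then obtain j where "j < length ds" "ds ! j = 0" by auto
    then show False using pos nth_mem by fastforce
  qed
  then have "ideal_gen n ?fs \<noteq> coord_ring n" using coord_ring_1 by blast
  moreover have "g \<in> ideal_gen n (take i ?fs)"
    if "i < length ds" "g \<in> coord_ring n" "g * ?fs ! i \<in> ideal_gen n (take i ?fs)" for i g
    using shift[of i g "Poly_Mapping.single i (ds ! i)"] that by (simp add: power_monomials_nth lookup_single)
  ultimately have "regular_sequence n ?fs" by (simp add: regular_sequence_def)
  moreover have "saturated n (ideal_gen n ?fs)"
    unfolding saturated_def
  proof (intro ballI impI, elim exE)
    fix g :: "'k mpoly" and N assume g: "g \<in> coord_ring n" and h: "\<forall>h\<in>forms n N. h * g \<in> ideal_gen n ?fs"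
    have "Poly_Mapping.single (Poly_Mapping.single n N) 1 \<in> (forms n N :: 'k mpoly set)"
      by (auto simp: forms_def coord_ring_def)
    then have "g * Poly_Mapping.single (Poly_Mapping.single n N) 1 \<in> ideal_gen n ?fs"
      using h by (metis mult.commute)
    then show "g \<in> ideal_gen n ?fs"
      using shift[of "length ds" g "Poly_Mapping.single n N"] g n by (simp add: lookup_single)
  qed
  ultimately show ?thesis
    unfolding complete_intersection_def using pos n power_monomials_forms
    by (intro conjI exI[of _ ?fs]) auto
qed

section \<open>Firm pairs\<close>

text \<open>The bound \<open>m\<close> is the largest exponent of a power sum that the uniqueness argument uses; for \<open>c = 1\<close> the
product suffices.\<close>

lemma firm_if:
  assumes cm: "(c, m) \<in> {(1, 0), (2, 1), (3, 2), (4, 4), (5, 6), (6, 8)}"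
  shows "firm TYPE('k::field) c (c + m)"
  unfolding firm_def
proof (intro conjI allI impI)
  show "1 \<le> c" "c \<le> c + m" using cm by auto
  fix as bs and X Y :: "'k mpoly set"
  assume l: "length as = c" "length bs = c"
    and X: "complete_intersection (c + m) as X" and Y: "complete_intersection (c + m) bs Y"
    and eq: "hilbert_polynomial (c + m) X = hilbert_polynomial (c + m) Y"
  let ?r = "map (of_nat :: nat \<Rightarrow> rat)"
  have pos: "\<forall>a\<in>set as. 0 < a" "\<forall>b\<in>set bs. 0 < b" using X Y by (auto simp: complete_intersection_def)
  have dvd: "[:1, -1::rat:] ^ (c + m + 1) dvd hilbert_numerator as - hilbert_numerator bs"
    using eq unfolding hilbert_polynomial_eq_iff[OF X Y] by simp
  note H = dvd[unfolded hilbert_numerator_contact_iff[OF l pos(1)]]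
  have pr: "prod_list (?r l) = of_nat (prod_list l)" for l by (induction l) simp_all
  have ps: "psum k (?r l) = of_nat (psum k l)" for k l by (induction l) simp_all
  have "mset (?r as) = mset (?r bs)"
  proof (rule mset_eq_of_psums[OF _ _ _ _ cm])
    show "psum k (?r as) = psum k (?r bs)" if k: "k \<in> {1, 2, 4, 6, 8}" and "k \<le> m" for k
    proof -
      have "(log_deriv_exp $ k :: rat) \<noteq> 0" using k log_deriv_exp_nth by auto
      then have "psum k as = psum k bs" using H \<open>k \<le> m\<close> by blast
      then show ?thesis by (simp add: ps)
    qed
  qed (use l pos H in \<open>auto simp: pr\<close>)
  then have "image_mset (of_nat :: nat \<Rightarrow> rat) (mset as) = image_mset of_nat (mset bs)" by simp
  then show "mset as = mset bs" by (rule multiset.inj_map_strong[rotated]) simp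
qed

text \<open>Two degree sequences refute firmness in every \<open>\<P>\<^sup>n\<close> with \<open>n \<le> c + m\<close> once they agree in the product and in
the power sums that the Hilbert polynomial sees up to exponent \<open>m\<close>. For \<open>n < c\<close> the pair is not firm by
definition.\<close>

lemma not_firm_if:
  fixes as bs :: "nat list"
  assumes l: "length as = c" "length bs = c" and pos: "\<forall>a\<in>set as. 0 < a" "\<forall>b\<in>set bs. 0 < b"
    and ne: "\<not> set as \<subseteq> set bs" and prod: "prod_list as = prod_list bs"
    and m: "m \<le> 7" and ps: "\<forall>k\<in>{1, 2, 4, 6}. k \<le> m \<longrightarrow> psum k as = psum k bs"
    and n: "n \<le> c + m"
  shows "\<not> firm TYPE('k::field) c n"
proof
  assume f: "firm TYPE('k) c n"
  then have cn: "c \<le> n" by (simp add: firm_def)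
  let ?X = "ideal_gen n (power_monomials as) :: 'k mpoly set"
  let ?Y = "ideal_gen n (power_monomials bs) :: 'k mpoly set"
  have X: "complete_intersection n as ?X"
    using complete_intersection_power_monomials[OF pos(1)] l cn by simp
  have Y: "complete_intersection n bs ?Y"
    using complete_intersection_power_monomials[OF pos(2)] l cn by simp
  have "(log_deriv_exp $ k :: rat) = 0 \<or> psum k as = psum k bs" if "k \<le> n - c" for k
  proof (cases "k \<in> {0, 3, 5, 7}")
    case True
    then show ?thesis using log_deriv_exp_nth by auto
  next
    case False
    moreover have "k \<le> m" using that n by simp
    ultimately have "k \<in> {1, 2, 4, 6}" using m by (simp, presburger)
    then show ?thesis using ps \<open>k \<le> m\<close> by blast
  qed
  then have "[:1, -1::rat:] ^ (c + (n - c) + 1) dvd hilbert_numerator as - hilbert_numerator bs"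
    unfolding hilbert_numerator_contact_iff[OF l pos(1)] using prod by blast
  then have eq: "hilbert_polynomial n ?X = hilbert_polynomial n ?Y"
    unfolding hilbert_polynomial_eq_iff[OF X Y] using cn by simp
  have "mset as = mset bs"
    using f[unfolded firm_def, THEN conjunct2, THEN conjunct2, rule_format, OF l X Y eq] .
  then have "set as = set bs" by (rule mset_eq_setD)
  then show False using ne by simp
qed

lemma firm_threshold_eq:
  assumes "firm TYPE('k::field) c N" and "\<And>n. n < N \<Longrightarrow> \<not> firm TYPE('k) c n"
  shows "firm_threshold TYPE('k) c = enat N"
  unfolding firm_threshold_def
proof (rule antisym)
  show "Inf (enat ` {n. firm TYPE('k) c n}) \<le> enat N" using assms(1) by (intro Inf_lower) simp
  show "enat N \<le> Inf (enat ` {n. firm TYPE('k) c n})"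
    using assms(2) by (intro Inf_greatest) (auto simp: not_less[symmetric])
qed

theorem theorem4p1:
  shows "firm_threshold TYPE('k::{alg_closed_field, field_char_0}) 1 = 1 \<and>
         firm_threshold TYPE('k) 2 = 3 \<and>
         firm_threshold TYPE('k) 3 = 5 \<and>
         firm_threshold TYPE('k) 4 = 8 \<and>
         firm_threshold TYPE('k) 5 = 11 \<and>
         firm_threshold TYPE('k) 6 = 14"
proof (intro conjI)
  have "firm_threshold TYPE('k) 1 = enat 1"
  proof (rule firm_threshold_eq)
    show "firm TYPE('k) 1 1" using firm_if[of 1 0] by simp
    show "\<not> firm TYPE('k) 1 n" if "n < 1" for n using that by (simp add: firm_def)
  qed
  then show "firm_threshold TYPE('k) 1 = 1" by (simp add: one_enat_def)
  \<comment> \<open>The pairs of degree sequences below were found by a computer search over tuples of small smooth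
    numbers, since the two sequences must involve the same primes.\<close>
  have "firm_threshold TYPE('k) 2 = enat 3"
  proof (rule firm_threshold_eq)
    show "firm TYPE('k) 2 3" using firm_if[of 2 1] by simp
    show "\<not> firm TYPE('k) 2 n" if "n < 3" for n
      by (rule not_firm_if[of "[1, 4]" 2 "[2, 2]" 0]) (use that in auto)
  qed
  then show "firm_threshold TYPE('k) 2 = 3" by (simp add: numeral_eq_enat)
  have "firm_threshold TYPE('k) 3 = enat 5"
  proof (rule firm_threshold_eq)
    show "firm TYPE('k) 3 5" using firm_if[of 3 2] by simp
    show "\<not> firm TYPE('k) 3 n" if "n < 5" for n
      by (rule not_firm_if[of "[1, 6, 6]" 3 "[2, 2, 9]" 1]) (use that in auto)
  qed
  then show "firm_threshold TYPE('k) 3 = 5" by (simp add: numeral_eq_enat)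
  have "firm_threshold TYPE('k) 4 = enat 8"
  proof (rule firm_threshold_eq)
    show "firm TYPE('k) 4 8" using firm_if[of 4 4] by simp
    show "\<not> firm TYPE('k) 4 n" if "n < 8" for n
      by (rule not_firm_if[of "[3, 10, 14, 36]" 4 "[4, 6, 18, 35]" 3]) (use that in auto)
  qed
  then show "firm_threshold TYPE('k) 4 = 8" by (simp add: numeral_eq_enat)
  have "firm_threshold TYPE('k) 5 = enat 11"
  proof (rule firm_threshold_eq)
    show "firm TYPE('k) 5 11" using firm_if[of 5 6] by simp
    show "\<not> firm TYPE('k) 5 n" if "n < 11" for n
      by (rule not_firm_if[of "[9, 20, 24, 42, 55]" 5 "[10, 15, 33, 36, 56]" 5]) (use that in auto)
  qed
  then show "firm_threshold TYPE('k) 5 = 11" by (simp add: numeral_eq_enat)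
  have "firm_threshold TYPE('k) 6 = enat 14"
  proof (rule firm_threshold_eq)
    show "firm TYPE('k) 6 14" using firm_if[of 6 8] by simp
    show "\<not> firm TYPE('k) 6 n" if "n < 14" for n
      by (rule not_firm_if[of "[8, 16, 24, 45, 55, 66]" 6 "[10, 11, 33, 36, 60, 64]" 7]) (use that in auto)
  qed
  then show "firm_threshold TYPE('k) 6 = 14" by (simp add: numeral_eq_enat)
qed

end
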